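(* Let $q_0>0$ satisfy $$\frac{(T_0-T_{0l})k_l}{\sqrt{\pi \alpha_l}}<q_0<\frac{(T_0-T_{0s})k_l}{\sqrt{\pi \alpha_l}}.$$ Then the free boundary problem $(P_1)$ (stated in the context) has a unique solution of similarity type. It is given by $$s(t)=2\lambda \sqrt{\alpha_s t},\quad t>0,$$ $$T_s(x,t)=\Big(T_k-\frac{q_0}{k_s} \sqrt{\pi\alpha_s}\,\mathrm{erf}(\lambda)\Big)+\frac{q_0}{k_s}\sqrt{\pi\alpha_s}\, \mathrm{erf}\Big(\frac{x}{2 \sqrt{\alpha_s t}}\Big), \quad 0<x<s(t),\ t>0,$$ $$T_l(x,t)=T_0+\frac{T_k-T_0}{\mathrm{erfc}\big(\sqrt{\alpha_s/\alpha_l}\,\lambda\big)}+\frac{T_0-T_k}{\mathrm{erfc}\big(\sqrt{\alpha_s/\alpha_l}\,\lambda\big)}\,\mathrm{erf}\Big(\frac{x}{2 \sqrt{\alpha_l t}}\Big), \quad x>s(t),\ t>0,$$ $$C_s(x,t)=f_s(T_k), \quad 0<x<s(t),\ t>0,$$ $$C_l(x,t)=C_0+\frac{f_l(T_k)-C_0}{\mathrm{erfc}\big(\sqrt{\alpha_s/d_l}\,\lambda\big)}\,\mathrm{erfc}\Big(\frac{x}{2 \sqrt{d_l t}}\Big), \quad x>s(t),\ t>0,$$ where the unknowns $T_k$ and $\lambda$ satisfy $$T_k=F(\lambda),\quad M(\lambda)=\phi(T_k),\quad \lambda>0,\quad T_A<T_k<T_B,$$ with $F$, $M$, $\phi$ the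 functions defined in the context.
   Context: Data. $\alpha_s,\alpha_l,d_s,d_l,k_s,k_l,\rho,\gamma$ are positive constants (subscripts $s$, $l$: solid, liquid). $T_A<T_B$ are real numbers, and $f_l,f_s:[T_A,T_B]\to\mathbb R$ are continuous strictly increasing functions (liquidus and solidus curves) with $$f_l(T_A)=f_s(T_A)<f_l(T)<f_s(T)<f_l(T_B)=f_s(T_B),\quad T_A<T<T_B.$$ $C_0$ is a constant with $f_l(T_A)<C_0<f_l(T_B)$, and $T_{0l}=f_l^{-1}(C_0)$, $T_{0s}=f_s^{-1}(C_0)$. $T_0$ is a constant with $T_A<T_0<T_B$. The alloy is initially liquid, i.e. $C_0<f_l(T_0)$. Problem $(P_1)$. Find a free boundary $s(t)>0$ ($t>0$), a constant $T_k\in(T_A,T_B)$, functions $T_s,C_s$ on $0<x<s(t)$, $t>0$, and functions $T_l,C_l$ on $x>s(t)$, $t>0$, such that, for all $t>0$ (initial and boundary values being understood as limits): (i) $\alpha_s T_{s,xx}=T_{s,t}$ for $0<x<s(t)$; (ii) $\alpha_l T_{l,xx}=T_{l,t}$ for $x>s(t)$; (iii) $d_s C_{s,xx}=C_{s,t}$ for $0<x<s(t)$; (iv) $d_l C_{l,xx}=C_{l,t}$ for $x>s(t)$; (v) $k_s T_{s,x}(0,t)=q_0/\sqrt t$; (vi) $T_s(s(t),t)=T_l(s(t),t)=T_k$; (vii) $T_l(x,0)=T_0$ for $x>0$; (viii) $T_l(\infty,t)=T_0$; (ix) $C_{s,x}(0,t)=0$; (x) $C_s(s(t),t)=f_s(T_k)$;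 (xi) $C_l(x,0)=C_0$ for $x>0$; (xii) $C_l(s(t),t)=f_l(T_k)$; (xiii) $k_sT_{s,x}(s(t),t)-k_lT_{l,x}(s(t),t)=\gamma\rho s'(t)$; (xiv) $d_lC_{l,x}(s(t),t)-d_sC_{s,x}(s(t),t)=[f_s(T_k)-f_l(T_k)]s'(t)$. A solution is of similarity type if each of $T_s,T_l,C_s,C_l$ has the form $A+B\,\mathrm{erf}\big(x/(2\sqrt{\kappa t})\big)$ with real constants $A,B$ (depending on the function), where $\kappa=\alpha_s,\alpha_l,d_s,d_l$ respectively. Functions. $\mathrm{erf}(x)=\frac{2}{\sqrt\pi}\int_0^x e^{-t^2}dt$, $\mathrm{erfc}=1-\mathrm{erf}$, and for $x>0$ $$Q(x)=\sqrt{\pi}\,x e^{x^2}\mathrm{erfc}(x),\quad F_1(x)=e^{x^2}\mathrm{erfc}(x),$$ $$F(x)=T_0+\frac{\gamma\rho\alpha_l}{k_l}Q\big(\sqrt{\alpha_s/\alpha_l}\,x\big)-\frac{q_0}{k_l}\sqrt{\alpha_l\pi}\,e^{-x^2}F_1\big(\sqrt{\alpha_s/\alpha_l}\,x\big),\quad M(x)=\Big[Q\big(\sqrt{\alpha_s/d_l}\,x\big)\Big]^{-1},$$ $$\phi(x)=\frac{f_s(x)-f_l(x)}{C_0-f_l(x)},\quad x\in(T_A,T_{0l})\cup(T_{0l},T_B).$$ *)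

theory Defs
  imports "HOL-Analysis.Analysis"
begin

definition erf :: "real \<Rightarrow> real" where
  "erf x = 2 / sqrt pi * (LBINT t=ereal 0..ereal x. exp (- t\<^sup>2))"

definition erfc :: "real \<Rightarrow> real" where
  "erfc x = 1 - erf x"

text \<open>
  Data of the solidification problem for a binary alloy. The liquidus \<open>f_l\<close> and the solidus
  \<open>f_s\<close> are used only on \<open>{T_A..T_B}\<close>; \<open>q_0\<close> (the heat flux coefficient at \<open>x = 0\<close>) is kept
  separate.
\<close>

record alloy =
  alpha_s :: real
  alpha_l :: real
  d_s :: real
  d_l :: real
  k_s :: real
  k_l :: real
  rho :: real
  gam :: real
  T_A :: real
  T_B :: real
  f_l :: "real \<Rightarrow> real"
  f_s :: "real \<Rightarrow> real"
  C_0 :: real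
  T_0 :: real

definition initially_liquid_alloy :: "alloy \<Rightarrow> bool" where
  "initially_liquid_alloy A \<longleftrightarrow>
     alpha_s A > 0 \<and> alpha_l A > 0 \<and> d_s A > 0 \<and> d_l A > 0 \<and> k_s A > 0 \<and> k_l A > 0 \<and>
     rho A > 0 \<and> gam A > 0 \<and>
     T_A A < T_B A \<and>
     continuous_on {T_A A..T_B A} (f_l A) \<and> strict_mono_on {T_A A..T_B A} (f_l A) \<and>
     continuous_on {T_A A..T_B A} (f_s A) \<and> strict_mono_on {T_A A..T_B A} (f_s A) \<and>
     f_l A (T_A A) = f_s A (T_A A) \<and> f_l A (T_B A) = f_s A (T_B A) \<and>
     (\<forall>T. T_A A < T \<and> T < T_B A \<longrightarrow>
        f_s A (T_A A) < f_l A T \<and> f_l A T < f_s A T \<and> f_s A T < f_l A (T_B A)) \<and>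
     f_l A (T_A A) < C_0 A \<and> C_0 A < f_l A (T_B A) \<and>
     T_A A < T_0 A \<and> T_0 A < T_B A \<and>
     C_0 A < f_l A (T_0 A)"

definition T_0l :: "alloy \<Rightarrow> real" where
  "T_0l A = inv_into {T_A A..T_B A} (f_l A) (C_0 A)"

definition T_0s :: "alloy \<Rightarrow> real" where
  "T_0s A = inv_into {T_A A..T_B A} (f_s A) (C_0 A)"

definition Q_fun :: "real \<Rightarrow> real" where
  "Q_fun x = sqrt pi * x * exp (x\<^sup>2) * erfc x"

definition F1_fun :: "real \<Rightarrow> real" where
  "F1_fun x = exp (x\<^sup>2) * erfc x"

definition F_fun :: "alloy \<Rightarrow> real \<Rightarrow> real \<Rightarrow> real" where
  "F_fun A q0 x =
     T_0 A + gam A * rho A * alpha_l A / k_l A * Q_fun (sqrt (alpha_s A / alpha_l A) * x)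
     - q0 / k_l A * sqrt (alpha_l A * pi) * exp (- x\<^sup>2) * F1_fun (sqrt (alpha_s A / alpha_l A) * x)"

definition M_fun :: "alloy \<Rightarrow> real \<Rightarrow> real" where
  "M_fun A x = inverse (Q_fun (sqrt (alpha_s A / d_l A) * x))"

definition phi_fun :: "alloy \<Rightarrow> real \<Rightarrow> real" where
  "phi_fun A T = (f_s A T - f_l A T) / (C_0 A - f_l A T)"

text \<open>
  The condition \<open>Tk \<noteq> T_0l A\<close> is the restriction of \<open>phi_fun A\<close> to its domain (in HOL the
  quotient is also defined there).
\<close>

definition coefficient_system :: "alloy \<Rightarrow> real \<Rightarrow> real \<Rightarrow> real \<Rightarrow> bool" where
  "coefficient_system A q0 Tk lam \<longleftrightarrow>
     Tk = F_fun A q0 lam \<and> M_fun A lam = phi_fun A Tk \<and>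
     lam > 0 \<and> T_A A < Tk \<and> Tk < T_B A \<and> Tk \<noteq> T_0l A"

text \<open>
  The unknowns: the functions are total in HOL, but \<open>front\<close> matters only for \<open>t > 0\<close>, \<open>temp_s\<close>
  and \<open>conc_s\<close> only on the solid region and \<open>temp_l\<close> and \<open>conc_l\<close> only on the liquid region.
  Functions of two variables take the position \<open>x\<close> first and the time \<open>t\<close> second.
\<close>

record alloy_state =
  front :: "real \<Rightarrow> real"
  temp_k :: real
  temp_s :: "real \<Rightarrow> real \<Rightarrow> real"
  temp_l :: "real \<Rightarrow> real \<Rightarrow> real"
  conc_s :: "real \<Rightarrow> real \<Rightarrow> real"
  conc_l :: "real \<Rightarrow> real \<Rightarrow> real"

definition solid_region :: "alloy_state \<Rightarrow> (real \<times> real) set" where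
  "solid_region u = {(x, t). t > 0 \<and> 0 < x \<and> x < front u t}"

definition liquid_region :: "alloy_state \<Rightarrow> (real \<times> real) set" where
  "liquid_region u = {(x, t). t > 0 \<and> x > front u t}"

definition dx :: "(real \<Rightarrow> real \<Rightarrow> real) \<Rightarrow> real \<Rightarrow> real \<Rightarrow> real" where
  "dx v x t = deriv (\<lambda>y. v y t) x"

definition dt :: "(real \<Rightarrow> real \<Rightarrow> real) \<Rightarrow> real \<Rightarrow> real \<Rightarrow> real" where
  "dt v x t = deriv (\<lambda>\<tau>. v x \<tau>) t"

definition heat_equation ::
    "real \<Rightarrow> (real \<times> real) set \<Rightarrow> (real \<Rightarrow> real \<Rightarrow> real) \<Rightarrow> bool" where
  "heat_equation \<kappa> R v \<longleftrightarrow>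
     (\<forall>(x, t) \<in> R.
        (\<lambda>y. v y t) differentiable (at x) \<and>
        (\<lambda>y. dx v y t) differentiable (at x) \<and>
        (\<lambda>\<tau>. v x \<tau>) differentiable (at t) \<and>
        \<kappa> * dx (dx v) x t = dt v x t)"

text \<open>
  Initial and boundary values are one-sided limits from within the region. An initial value at
  every \<open>x > 0\<close> makes sense only if each \<open>x > 0\<close> lies in the liquid region for all small
  \<open>t > 0\<close>; this is the first conjunct below.
\<close>

definition initial_value :: "alloy_state \<Rightarrow> (real \<Rightarrow> real \<Rightarrow> real) \<Rightarrow> real \<Rightarrow> bool" where
  "initial_value u v c \<longleftrightarrow>
     (\<forall>x>0. (\<forall>\<^sub>F t in at_right 0. (x, t) \<in> liquid_region u) \<and> ((\<lambda>t. v x t) \<longlongrightarrow> c) (at_right 0))"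

definition solves_P1 :: "alloy \<Rightarrow> real \<Rightarrow> alloy_state \<Rightarrow> bool" where
  "solves_P1 A q0 u \<longleftrightarrow>
     (\<forall>t>0. front u t > 0 \<and> front u differentiable (at t)) \<and>
     T_A A < temp_k u \<and> temp_k u < T_B A \<and>
     heat_equation (alpha_s A) (solid_region u) (temp_s u) \<and>
     heat_equation (alpha_l A) (liquid_region u) (temp_l u) \<and>
     heat_equation (d_s A) (solid_region u) (conc_s u) \<and>
     heat_equation (d_l A) (liquid_region u) (conc_l u) \<and>
     (\<forall>t>0. ((\<lambda>x. k_s A * dx (temp_s u) x t) \<longlongrightarrow> q0 / sqrt t) (at_right 0)) \<and>
     (\<forall>t>0. ((\<lambda>x. temp_s u x t) \<longlongrightarrow> temp_k u) (at_left (front u t)) \<and>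
            ((\<lambda>x. temp_l u x t) \<longlongrightarrow> temp_k u) (at_right (front u t))) \<and>
     initial_value u (temp_l u) (T_0 A) \<and>
     (\<forall>t>0. ((\<lambda>x. temp_l u x t) \<longlongrightarrow> T_0 A) at_top) \<and>
     (\<forall>t>0. ((\<lambda>x. dx (conc_s u) x t) \<longlongrightarrow> 0) (at_right 0)) \<and>
     (\<forall>t>0. ((\<lambda>x. conc_s u x t) \<longlongrightarrow> f_s A (temp_k u)) (at_left (front u t))) \<and>
     initial_value u (conc_l u) (C_0 A) \<and>
     (\<forall>t>0. ((\<lambda>x. conc_l u x t) \<longlongrightarrow> f_l A (temp_k u)) (at_right (front u t))) \<and>
     (\<forall>t>0. \<exists>a b.
        ((\<lambda>x. dx (temp_s u) x t) \<longlongrightarrow> a) (at_left (front u t)) \<and>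
        ((\<lambda>x. dx (temp_l u) x t) \<longlongrightarrow> b) (at_right (front u t)) \<and>
        k_s A * a - k_l A * b = gam A * rho A * deriv (front u) t) \<and>
     (\<forall>t>0. \<exists>a b.
        ((\<lambda>x. dx (conc_l u) x t) \<longlongrightarrow> a) (at_right (front u t)) \<and>
        ((\<lambda>x. dx (conc_s u) x t) \<longlongrightarrow> b) (at_left (front u t)) \<and>
        d_l A * a - d_s A * b = (f_s A (temp_k u) - f_l A (temp_k u)) * deriv (front u) t)"

definition similarity_form ::
    "real \<Rightarrow> (real \<times> real) set \<Rightarrow> (real \<Rightarrow> real \<Rightarrow> real) \<Rightarrow> bool" where
  "similarity_form \<kappa> R v \<longleftrightarrow>
     (\<exists>a b. \<forall>(x, t) \<in> R. v x t = a + b * erf (x / (2 * sqrt (\<kappa> * t))))"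

definition similarity_solution :: "alloy \<Rightarrow> real \<Rightarrow> alloy_state \<Rightarrow> bool" where
  "similarity_solution A q0 u \<longleftrightarrow>
     solves_P1 A q0 u \<and>
     similarity_form (alpha_s A) (solid_region u) (temp_s u) \<and>
     similarity_form (alpha_l A) (liquid_region u) (temp_l u) \<and>
     similarity_form (d_s A) (solid_region u) (conc_s u) \<and>
     similarity_form (d_l A) (liquid_region u) (conc_l u)"

definition explicit_state :: "alloy \<Rightarrow> real \<Rightarrow> real \<Rightarrow> real \<Rightarrow> alloy_state" where
  "explicit_state A q0 Tk lam =
     \<lparr>front = (\<lambda>t. 2 * lam * sqrt (alpha_s A * t)),
      temp_k = Tk,
      temp_s = (\<lambda>x t.
        (Tk - q0 / k_s A * sqrt (pi * alpha_s A) * erf lam)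
        + q0 / k_s A * sqrt (pi * alpha_s A) * erf (x / (2 * sqrt (alpha_s A * t)))),
      temp_l = (\<lambda>x t.
        T_0 A + (Tk - T_0 A) / erfc (sqrt (alpha_s A / alpha_l A) * lam)
        + (T_0 A - Tk) / erfc (sqrt (alpha_s A / alpha_l A) * lam)
          * erf (x / (2 * sqrt (alpha_l A * t)))),
      conc_s = (\<lambda>x t. f_s A Tk),
      conc_l = (\<lambda>x t.
        C_0 A + (f_l A Tk - C_0 A) / erfc (sqrt (alpha_s A / d_l A) * lam)
          * erfc (x / (2 * sqrt (d_l A * t))))\<rparr>"

text \<open>
  Equality of solutions as functions on their domains; once the fronts agree, both states have
  the same solid and liquid regions.
\<close>

definition same_state :: "alloy_state \<Rightarrow> alloy_state \<Rightarrow> bool" where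
  "same_state u v \<longleftrightarrow>
     (\<forall>t>0. front u t = front v t) \<and>
     temp_k u = temp_k v \<and>
     (\<forall>(x, t) \<in> solid_region u. temp_s u x t = temp_s v x t \<and> conc_s u x t = conc_s v x t) \<and>
     (\<forall>(x, t) \<in> liquid_region u. temp_l u x t = temp_l v x t \<and> conc_l u x t = conc_l v x t)"

end

theory Submission
  imports Defs "HOL-Probability.Distributions" "HOL-Real_Asymp.Real_Asymp"
begin

text \<open>
  A profile \<open>a + b * erf (x / (2 * sqrt (\<kappa> * t)))\<close> solves the heat equation with diffusivity
  \<open>\<kappa>\<close> whatever \<open>a\<close> and \<open>b\<close> are, so a similarity solution is a front together with four pairs of
  coefficients, and only the initial and boundary conditions restrict them.

  \<^item> The heat flux at \<open>x = 0\<close> makes the coefficient \<open>b\<close> of the solid temperature nonzero. As that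
    temperature is constant along the front, \<open>erf\<close> is constant at
    \<open>s(t) / (2 * sqrt (alpha_s * t))\<close>; since \<open>erf\<close> is injective, the front is the parabola
    \<open>s(t) = 2 * \<lambda> * sqrt (alpha_s * t)\<close> (\<open>similarity_front\<close>).

  \<^item> On such a front every remaining condition carries the same power of \<open>t\<close> on both sides, and the
    problem turns into ten algebraic equations (\<open>solves_P1_iff\<close>). Eight of them are linear in
    the coefficients and express these through \<open>T_k\<close> and \<open>\<lambda>\<close>. Once they are inserted, the energy
    balance reads \<open>T_k = F(\<lambda>)\<close> and the solute balance
    \<open>(f_s(T_k) - f_l(T_k)) * Q(\<nu> * \<lambda>) = C_0 - f_l(T_k)\<close> with \<open>\<nu> = sqrt (alpha_s / d_l)\<close>, which
    is \<open>M(\<lambda>) = \<phi>(T_k)\<close> cleared of denominators (\<open>profile_coefficients_iff\<close>).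

  What remains is one equation for \<open>\<lambda>\<close>. With \<open>T = F(\<lambda>)\<close> and \<open>Q = Q(\<nu> * \<lambda>)\<close> it says that the convex
  combination \<open>Q * f_s(T) + (1 - Q) * f_l(T)\<close> equals \<open>C_0\<close>. Here \<open>Q\<close> increases strictly with values
  in \<open>(0, 1)\<close>, \<open>F\<close> increases strictly, \<open>f_l\<close> and \<open>f_s\<close> increase strictly and \<open>f_l < f_s\<close>, so
  the combination increases strictly in \<open>\<lambda>\<close>: there is at most one root. The bounds on \<open>q_0\<close> say
  exactly that \<open>T_0s < F(0) < T_0l\<close>. At \<open>\<lambda> = 0\<close> the combination is \<open>f_l(F(0)) < C_0\<close>; \<open>F\<close> eventually
  exceeds every number below \<open>T_0\<close>, hence passes \<open>T_0l\<close>, and where it does the combination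
  exceeds \<open>C_0\<close>. The intermediate value theorem gives the root.

  The monotonicity of \<open>Q\<close> and \<open>F\<close> comes from a two-sided estimate of \<open>erfc\<close> by elementary
  functions (\<open>erfc_upper_bound\<close>, \<open>erfc_lower_bound\<close>).
\<close>

section \<open>The error function and its Mills ratio\<close>

lemma erf_has_real_derivative:
  "(erf has_real_derivative 2 / sqrt pi * exp (- x\<^sup>2)) (at x within S)"
proof -
  \<comment> \<open>an interval around \<open>x\<close> that also contains the base point \<open>0\<close> of the integral\<close>
  define a b where "a = - \<bar>x\<bar> - 1" and "b = \<bar>x\<bar> + 1"
  have ab: "a \<le> 0" "0 \<le> b" "a < x" "x < b"
    by (auto simp: a_def b_def)
  have "((\<lambda>u. LBINT t=ereal 0..ereal u. exp (- t\<^sup>2)) has_vector_derivative exp (- x\<^sup>2))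
          (at x within {a..b})"
    using ab by (intro interval_integral_FTC2) (auto intro!: continuous_intros)
  moreover have "at x within {a..b} = at x"
    using ab by (intro at_within_interior) auto
  ultimately have "((\<lambda>u. LBINT t=ereal 0..ereal u. exp (- t\<^sup>2)) has_real_derivative exp (- x\<^sup>2)) (at x)"
    by (simp add: has_real_derivative_iff_has_vector_derivative)
  from DERIV_cmult[OF this, of "2 / sqrt pi"]
  have "(erf has_real_derivative 2 / sqrt pi * exp (- x\<^sup>2)) (at x)"
    by (simp add: erf_def[abs_def])
  then show ?thesis
    by (rule has_field_derivative_at_within)
qed

lemmas erf_derivative [derivative_intros] = DERIV_chain2[OF erf_has_real_derivative]

lemma erf_0: "erf 0 = 0"
  by (simp add: erf_def zero_ereal_def[symmetric])

lemma erf_tendsto_1: "(erf \<longlongrightarrow> 1) at_top"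
proof -
  let ?g = "\<lambda>x::real. indicator {0..} x *\<^sub>R exp (- x\<^sup>2)"
  have int: "integrable lborel ?g" and val: "integral\<^sup>L lborel ?g = sqrt pi / 2"
    using gaussian_moment_0 by (auto simp: has_bochner_integral_iff)
  have "((\<lambda>y. \<integral>x. indicator {..y} x *\<^sub>R ?g x \<partial>lborel) \<longlongrightarrow> integral\<^sup>L lborel ?g) at_top"
    by (rule tendsto_integral_at_top[OF _ int]) simp
  then have "((\<lambda>y. 2 / sqrt pi * (\<integral>x. indicator {..y} x *\<^sub>R ?g x \<partial>lborel))
      \<longlongrightarrow> 2 / sqrt pi * (sqrt pi / 2)) at_top"
    unfolding val by (intro tendsto_intros)
  moreover have "\<forall>\<^sub>F y in at_top. 2 / sqrt pi * (\<integral>x. indicator {..y} x *\<^sub>R ?g x \<partial>lborel) = erf y"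
    using eventually_ge_at_top[of 0]
  proof eventually_elim
    case (elim y)
    have "(\<integral>x. indicator {..y} x *\<^sub>R ?g x \<partial>lborel) = (LBINT t:{0..y}. exp (- t\<^sup>2))"
      unfolding set_lebesgue_integral_def
      by (intro Bochner_Integration.integral_cong) (auto simp: indicator_def)
    also have "\<dots> = (LBINT t=ereal 0..ereal y. exp (- t\<^sup>2))"
      using elim by (subst interval_integral_Icc) auto
    finally show ?case
      by (simp add: erf_def)
  qed
  ultimately show ?thesis
    by (simp add: tendsto_cong)
qed

lemma strict_mono_erf: "strict_mono erf"
  by (rule strict_monoI, rule DERIV_pos_imp_increasing)
    (auto intro!: exI erf_has_real_derivative)

lemma erfc_has_real_derivative:
  "(erfc has_real_derivative - (2 / sqrt pi * exp (- x\<^sup>2))) (at x within S)"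
  unfolding erfc_def[abs_def] by (auto intro!: derivative_eq_intros)

lemmas erfc_derivative [derivative_intros] = DERIV_chain2[OF erfc_has_real_derivative]

lemma erfc_tendsto_0: "(erfc \<longlongrightarrow> 0) at_top"
  unfolding erfc_def[abs_def] using tendsto_diff[OF tendsto_const[of 1] erf_tendsto_1] by simp

lemma erfc_pos: "0 < erfc x"
  by (rule DERIV_neg_imp_decreasing_at_top[OF _ erfc_tendsto_0])
    (auto intro!: exI erfc_has_real_derivative)

lemma F1_fun_pos: "0 < F1_fun x"
  by (simp add: F1_fun_def erfc_pos)

lemma Q_fun_eq: "Q_fun x = sqrt pi * x * F1_fun x"
  by (simp add: Q_fun_def F1_fun_def)

lemma Q_fun_pos: "0 < x \<Longrightarrow> 0 < Q_fun x"
  by (simp add: Q_fun_eq F1_fun_pos)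

text \<open>
  The difference of the two sides tends to \<open>0\<close> at infinity and has the derivative
  \<open>- exp (- x\<^sup>2) / (sqrt pi * x\<^sup>2)\<close>, so it decreases to \<open>0\<close> and is positive.
\<close>

lemma erfc_upper_bound:
  assumes "0 < x"
  shows "erfc x < 1 / sqrt pi * (exp (- x\<^sup>2) / x)"
proof -
  let ?h = "\<lambda>x. 1 / sqrt pi * (exp (- x\<^sup>2) / x) - erfc x"
  have lim: "(?h \<longlongrightarrow> 0 - 0) at_top"
    by (intro tendsto_diff erfc_tendsto_0) real_asymp
  have "\<exists>d. (?h has_real_derivative d) (at y) \<and> d < 0" if "x \<le> y" for y
  proof (intro exI conjI)
    have y: "0 < y" using that assms by simp
    have "((\<lambda>x. exp (- x\<^sup>2) / x) has_real_derivative - (2 * exp (- y\<^sup>2)) - exp (- y\<^sup>2) / y\<^sup>2) (at y)"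
      using y by (auto intro!: derivative_eq_intros simp: field_simps power2_eq_square)
    from DERIV_cmult[OF this, of "1 / sqrt pi"]
    show "(?h has_real_derivative 1 / sqrt pi * (- (2 * exp (- y\<^sup>2)) - exp (- y\<^sup>2) / y\<^sup>2)
        - (- (2 / sqrt pi * exp (- y\<^sup>2)))) (at y)"
      by (intro DERIV_diff erfc_has_real_derivative)
    have "1 / sqrt pi * (- (2 * exp (- y\<^sup>2)) - exp (- y\<^sup>2) / y\<^sup>2) - (- (2 / sqrt pi * exp (- y\<^sup>2)))
        = - (1 / sqrt pi * (exp (- y\<^sup>2) / y\<^sup>2))"
      by (simp add: algebra_simps)
    also have "\<dots> < 0"
      using y by simp
    finally show "1 / sqrt pi * (- (2 * exp (- y\<^sup>2)) - exp (- y\<^sup>2) / y\<^sup>2)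
        - (- (2 / sqrt pi * exp (- y\<^sup>2))) < 0" .
  qed
  from DERIV_neg_imp_decreasing_at_top[OF this lim]
  show ?thesis by simp
qed

text \<open>
  The rational factor \<open>x / (1 + 2 * x\<^sup>2)\<close> is the one for which the derivative of \<open>Q_fun\<close> is
  positive exactly when this bound holds. The proof is again by monotone decrease to \<open>0\<close>: the
  difference of the two sides has a derivative of constant sign because
  \<open>((1 - 2 * x\<^sup>2) * (1 + 2 * x\<^sup>2) - 4 * x\<^sup>2) + (1 + 2 * x\<^sup>2)\<^sup>2 = 2\<close>.
\<close>

lemma erfc_lower_bound:
  assumes "0 \<le> x"
  shows "2 / sqrt pi * (x * exp (- x\<^sup>2) / (1 + 2 * x\<^sup>2)) < erfc x"
proof -
  let ?h = "\<lambda>x. erfc x - 2 / sqrt pi * (x * exp (- x\<^sup>2) / (1 + 2 * x\<^sup>2))"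
  have lim: "(?h \<longlongrightarrow> 0 - 0) at_top"
    by (intro tendsto_diff erfc_tendsto_0) real_asymp
  have "\<exists>d. (?h has_real_derivative d) (at y) \<and> d < 0" if "x \<le> y" for y
  proof (intro exI conjI)
    have nz: "1 + 2 * y\<^sup>2 > 0" by (simp add: add_pos_nonneg)
    have "((\<lambda>y. y * exp (- y\<^sup>2) / (1 + 2 * y\<^sup>2)) has_real_derivative
        ((exp (- y\<^sup>2) + y * (exp (- y\<^sup>2) * (- (2 * y)))) * (1 + 2 * y\<^sup>2)
          - y * exp (- y\<^sup>2) * (4 * y)) / (1 + 2 * y\<^sup>2)\<^sup>2) (at y)"
      using nz by (auto intro!: derivative_eq_intros simp: power2_eq_square)
    then have "((\<lambda>y. y * exp (- y\<^sup>2) / (1 + 2 * y\<^sup>2)) has_real_derivative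
        exp (- y\<^sup>2) * (2 / (1 + 2 * y\<^sup>2)\<^sup>2 - 1)) (at y)"
    proof (rule DERIV_cong)
      have "(exp (- y\<^sup>2) + y * (exp (- y\<^sup>2) * (- (2 * y)))) * (1 + 2 * y\<^sup>2) - y * exp (- y\<^sup>2) * (4 * y)
          = exp (- y\<^sup>2) * (2 - (1 + 2 * y\<^sup>2)\<^sup>2)"
        by algebra
      then show "((exp (- y\<^sup>2) + y * (exp (- y\<^sup>2) * (- (2 * y)))) * (1 + 2 * y\<^sup>2)
            - y * exp (- y\<^sup>2) * (4 * y)) / (1 + 2 * y\<^sup>2)\<^sup>2
          = exp (- y\<^sup>2) * (2 / (1 + 2 * y\<^sup>2)\<^sup>2 - 1)"
        using nz by (simp add: diff_divide_distrib right_diff_distrib)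
    qed
    from DERIV_cmult[OF this, of "2 / sqrt pi"]
    show "(?h has_real_derivative - (2 / sqrt pi * exp (- y\<^sup>2)) -
       2 / sqrt pi * (exp (- y\<^sup>2) * (2 / (1 + 2 * y\<^sup>2)\<^sup>2 - 1))) (at y)"
      by (intro DERIV_diff erfc_has_real_derivative)
    have "- (2 / sqrt pi * exp (- y\<^sup>2)) - 2 / sqrt pi * (exp (- y\<^sup>2) * (2 / (1 + 2 * y\<^sup>2)\<^sup>2 - 1))
       = - (2 / sqrt pi * exp (- y\<^sup>2) * (2 / (1 + 2 * y\<^sup>2)\<^sup>2))"
      by (simp add: algebra_simps)
    also have "\<dots> < 0" using nz by simp
    finally show "- (2 / sqrt pi * exp (- y\<^sup>2)) - 2 / sqrt pi * (exp (- y\<^sup>2) * (2 / (1 + 2 * y\<^sup>2)\<^sup>2 - 1)) < 0" .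
  qed
  from DERIV_neg_imp_decreasing_at_top[OF this lim]
  show ?thesis by simp
qed

lemma Q_fun_less_1:
  assumes "0 < x"
  shows "Q_fun x < 1"
proof -
  have "sqrt pi * x * exp (x\<^sup>2) * erfc x
      < sqrt pi * x * exp (x\<^sup>2) * (1 / sqrt pi * (exp (- x\<^sup>2) / x))"
    using assms by (intro mult_strict_left_mono erfc_upper_bound) auto
  also have "\<dots> = 1"
    using assms by (simp add: field_simps exp_minus)
  finally show ?thesis
    by (simp add: Q_fun_def)
qed

text \<open>
  The derivative is linear in \<open>F1_fun\<close> itself; this turns bounds on \<open>erfc\<close> into monotonicity of
  \<open>F1_fun\<close> and \<open>Q_fun\<close>.
\<close>

lemma F1_fun_has_real_derivative:
  "(F1_fun has_real_derivative 2 * x * F1_fun x - 2 / sqrt pi) (at x within S)"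
  unfolding F1_fun_def[abs_def]
  by (auto intro!: derivative_eq_intros simp: algebra_simps exp_minus)

lemma F1_fun_lower_bound:
  assumes "0 \<le> x"
  shows "2 * x / sqrt pi < (1 + 2 * x\<^sup>2) * F1_fun x"
proof -
  have pos: "0 < 1 + 2 * x\<^sup>2" by (simp add: add_pos_nonneg)
  have "(1 + 2 * x\<^sup>2) * exp (x\<^sup>2) * (2 / sqrt pi * (x * exp (- x\<^sup>2) / (1 + 2 * x\<^sup>2)))
      < (1 + 2 * x\<^sup>2) * exp (x\<^sup>2) * erfc x"
    using pos by (intro mult_strict_left_mono erfc_lower_bound assms) auto
  also have "(1 + 2 * x\<^sup>2) * exp (x\<^sup>2) * (2 / sqrt pi * (x * exp (- x\<^sup>2) / (1 + 2 * x\<^sup>2)))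
      = 2 * x / sqrt pi"
  proof -
    have "D * E * (c * (x * E' / D)) = c * x" if "E * E' = 1" "D > 0" for c D E E' :: real
      using that by simp
    from this[of "exp (x\<^sup>2)" "exp (- x\<^sup>2)" "1 + 2 * x\<^sup>2" "2 / sqrt pi"] pos show ?thesis
      by (simp add: exp_minus)
  qed
  finally show ?thesis
    by (simp add: F1_fun_def mult.assoc)
qed

text \<open>
  The derivative \<open>2 * x * F1_fun x - 2 / sqrt pi\<close> is negative exactly when \<open>Q_fun x < 1\<close>.
\<close>

lemma F1_fun_strict_antimono:
  assumes "0 \<le> x" "x < y"
  shows "F1_fun y < F1_fun x"
proof (rule DERIV_neg_imp_decreasing_open[OF assms(2)])
  fix z assume "x < z" "z < y"
  then have "0 < z" using assms by simp
  then have "2 * z * F1_fun z < 2 / sqrt pi"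
    using Q_fun_less_1[of z] by (simp add: Q_fun_eq field_simps)
  then show "\<exists>d. (F1_fun has_real_derivative d) (at z) \<and> d < 0"
    by (intro exI[of _ "2 * z * F1_fun z - 2 / sqrt pi"] conjI F1_fun_has_real_derivative) simp
next
  show "continuous_on {x..y} F1_fun"
    using F1_fun_has_real_derivative by (intro DERIV_continuous_on)
qed

lemma Q_fun_strict_mono:
  assumes "0 \<le> x" "x < y"
  shows "Q_fun x < Q_fun y"
proof (rule DERIV_pos_imp_increasing[OF assms(2)])
  fix z assume "x \<le> z" "z \<le> y"
  then have z: "0 \<le> z" using assms by simp
  have "((\<lambda>z. sqrt pi * z * F1_fun z) has_real_derivative
      sqrt pi * z * (2 * z * F1_fun z - 2 / sqrt pi) + sqrt pi * F1_fun z) (at z)"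
    by (auto intro!: derivative_eq_intros DERIV_chain2[OF F1_fun_has_real_derivative])
  then have "(Q_fun has_real_derivative sqrt pi * ((1 + 2 * z\<^sup>2) * F1_fun z - 2 * z / sqrt pi)) (at z)"
    unfolding Q_fun_eq[abs_def]
    by (rule DERIV_cong) (simp add: algebra_simps power2_eq_square)
  moreover have "0 < sqrt pi * ((1 + 2 * z\<^sup>2) * F1_fun z - 2 * z / sqrt pi)"
    using F1_fun_lower_bound[OF z] by simp
  ultimately show "\<exists>d. (Q_fun has_real_derivative d) (at z) \<and> 0 < d"
    by blast
qed

lemma F1_fun_le_1: "0 \<le> x \<Longrightarrow> F1_fun x \<le> 1"
  using F1_fun_strict_antimono[of 0 x]
  by (cases "x = 0") (auto simp: F1_fun_def erfc_def erf_0)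

lemma continuous_on_F1_fun [continuous_intros]:
  "continuous_on S g \<Longrightarrow> continuous_on S (\<lambda>x. F1_fun (g x))"
  by (rule continuous_on_compose2[of UNIV F1_fun])
    (auto intro!: DERIV_continuous_on F1_fun_has_real_derivative)

lemma continuous_on_Q_fun [continuous_intros]:
  "continuous_on S g \<Longrightarrow> continuous_on S (\<lambda>x. Q_fun (g x))"
  unfolding Q_fun_eq by (intro continuous_intros)

section \<open>The equations for temperature and front coefficient\<close>

lemma T_0l_liquidus:
  assumes "initially_liquid_alloy A"
  shows "T_A A < T_0l A" "T_0l A < T_B A" "f_l A (T_0l A) = C_0 A"
proof -
  have "\<exists>T\<ge>T_A A. T \<le> T_B A \<and> f_l A T = C_0 A"
    using assms by (intro IVT') (auto simp: initially_liquid_alloy_def)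
  then obtain T where "T \<in> {T_A A..T_B A}" "f_l A T = C_0 A"
    by auto
  then have "C_0 A \<in> f_l A ` {T_A A..T_B A}"
    by (intro image_eqI[of _ _ T]) auto
  then have *: "f_l A (T_0l A) = C_0 A" "T_0l A \<in> {T_A A..T_B A}"
    unfolding T_0l_def by (simp_all only: f_inv_into_f inv_into_into)
  then have "T_0l A \<noteq> T_A A" "T_0l A \<noteq> T_B A"
    using assms by (auto simp: initially_liquid_alloy_def)
  with * show "T_A A < T_0l A" "T_0l A < T_B A" "f_l A (T_0l A) = C_0 A"
    by auto
qed

lemma T_0s_solidus:
  assumes "initially_liquid_alloy A"
  shows "T_A A < T_0s A" "T_0s A < T_B A" "f_s A (T_0s A) = C_0 A"
proof -
  have "\<exists>T\<ge>T_A A. T \<le> T_B A \<and> f_s A T = C_0 A"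
    using assms by (intro IVT') (auto simp: initially_liquid_alloy_def)
  then obtain T where "T \<in> {T_A A..T_B A}" "f_s A T = C_0 A"
    by auto
  then have "C_0 A \<in> f_s A ` {T_A A..T_B A}"
    by (intro image_eqI[of _ _ T]) auto
  then have *: "f_s A (T_0s A) = C_0 A" "T_0s A \<in> {T_A A..T_B A}"
    unfolding T_0s_def by (simp_all only: f_inv_into_f inv_into_into)
  then have "T_0s A \<noteq> T_A A" "T_0s A \<noteq> T_B A"
    using assms by (auto simp: initially_liquid_alloy_def)
  with * show "T_A A < T_0s A" "T_0s A < T_B A" "f_s A (T_0s A) = C_0 A"
    by auto
qed

lemma f_l_less_iff:
  assumes "initially_liquid_alloy A" "x \<in> {T_A A..T_B A}" "y \<in> {T_A A..T_B A}"
  shows "f_l A x < f_l A y \<longleftrightarrow> x < y"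
  using assms by (intro strict_mono_on_less[of "{T_A A..T_B A}"]) (auto simp: initially_liquid_alloy_def)

lemma f_s_less_iff:
  assumes "initially_liquid_alloy A" "x \<in> {T_A A..T_B A}" "y \<in> {T_A A..T_B A}"
  shows "f_s A x < f_s A y \<longleftrightarrow> x < y"
  using assms by (intro strict_mono_on_less[of "{T_A A..T_B A}"]) (auto simp: initially_liquid_alloy_def)

text \<open>
  The solute equation in a form without quotients. The condition \<open>Tk \<noteq> T_0l A\<close> is absorbed: the
  left side of that equation is positive for \<open>lam > 0\<close> and \<open>Tk\<close> strictly between \<open>T_A A\<close> and \<open>T_B A\<close>, so \<open>C_0 A \<noteq> f_l A Tk\<close>, and \<open>f_l A\<close> is injective.
\<close>

lemma coefficient_system_iff:
  assumes "initially_liquid_alloy A"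
  shows "coefficient_system A q0 Tk lam \<longleftrightarrow>
    0 < lam \<and> T_A A < Tk \<and> Tk < T_B A \<and> Tk = F_fun A q0 lam \<and>
    (f_s A Tk - f_l A Tk) * Q_fun (sqrt (alpha_s A / d_l A) * lam) = C_0 A - f_l A Tk"
proof (cases "0 < lam \<and> T_A A < Tk \<and> Tk < T_B A")
  case True
  note Tl = T_0l_liquidus[OF assms]
  have Q: "0 < Q_fun (sqrt (alpha_s A / d_l A) * lam)"
    using True assms by (intro Q_fun_pos) (auto simp: initially_liquid_alloy_def)
  have fs: "0 < f_s A Tk - f_l A Tk"
    using True assms by (auto simp: initially_liquid_alloy_def)
  have "Tk < T_0l A \<longleftrightarrow> f_l A Tk < C_0 A" "T_0l A < Tk \<longleftrightarrow> C_0 A < f_l A Tk"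
    using f_l_less_iff[OF assms, of Tk "T_0l A"] f_l_less_iff[OF assms, of "T_0l A" Tk] True Tl
    by auto
  then have ne: "Tk \<noteq> T_0l A \<longleftrightarrow> C_0 A - f_l A Tk \<noteq> 0"
    by linarith
  have "inverse Q = d / c \<and> c \<noteq> 0 \<longleftrightarrow> d * Q = c" if "0 < Q" "0 < d" for Q d c :: real
    using that by (auto simp: field_simps)
  from this[OF Q fs, of "C_0 A - f_l A Tk"]
  have "M_fun A lam = phi_fun A Tk \<and> Tk \<noteq> T_0l A \<longleftrightarrow>
      (f_s A Tk - f_l A Tk) * Q_fun (sqrt (alpha_s A / d_l A) * lam) = C_0 A - f_l A Tk"
    unfolding M_fun_def phi_fun_def ne .
  with True show ?thesis
    unfolding coefficient_system_def by blast
qed (auto simp: coefficient_system_def)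

text \<open>
  Both \<open>\<lambda>\<close>-dependent terms increase: \<open>Q_fun\<close> does, and the subtracted one is a product of two
  positive decreasing factors.
\<close>

lemma F_fun_strict_mono:
  assumes "initially_liquid_alloy A" "0 < q0" "0 \<le> x" "x < y"
  shows "F_fun A q0 x < F_fun A q0 y"
proof -
  let ?m = "sqrt (alpha_s A / alpha_l A)"
  have m: "0 < ?m" and pos: "0 < gam A * rho A * alpha_l A / k_l A" "0 < q0 / k_l A * sqrt (alpha_l A * pi)"
    using assms by (auto simp: initially_liquid_alloy_def)
  have "Q_fun (?m * x) < Q_fun (?m * y)"
    using assms m by (intro Q_fun_strict_mono) auto
  then have "gam A * rho A * alpha_l A / k_l A * Q_fun (?m * x) < gam A * rho A * alpha_l A / k_l A * Q_fun (?m * y)"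
    using pos by (intro mult_strict_left_mono)
  moreover have "exp (- y\<^sup>2) * F1_fun (?m * y) < exp (- x\<^sup>2) * F1_fun (?m * x)"
  proof (intro mult_strict_mono)
    show "exp (- y\<^sup>2) < exp (- x\<^sup>2)"
      using assms power_strict_mono[of x y 2] by simp
    show "F1_fun (?m * y) < F1_fun (?m * x)"
      using assms m by (intro F1_fun_strict_antimono) auto
  qed (auto intro: less_imp_le F1_fun_pos)
  then have "q0 / k_l A * sqrt (alpha_l A * pi) * (exp (- y\<^sup>2) * F1_fun (?m * y))
      < q0 / k_l A * sqrt (alpha_l A * pi) * (exp (- x\<^sup>2) * F1_fun (?m * x))"
    using pos by (intro mult_strict_left_mono)
  ultimately show ?thesis
    unfolding F_fun_def by (simp only: mult.assoc)
qed

lemma continuous_on_F_fun: "continuous_on S (F_fun A q0)"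
  unfolding F_fun_def[abs_def] by (intro continuous_intros)

lemma F_fun_0: "F_fun A q0 0 = T_0 A - q0 * sqrt (pi * alpha_l A) / k_l A"
  by (simp add: F_fun_def Q_fun_def F1_fun_def erfc_def erf_0 mult.commute)

text \<open>
  The \<open>Q_fun\<close> term is positive and the flux term is at most a multiple of \<open>exp (- x\<^sup>2)\<close>, as
  \<open>F1_fun \<le> 1\<close>.
\<close>

lemma F_fun_eventually_greater:
  assumes "initially_liquid_alloy A" "0 < q0" "T < T_0 A"
  shows "\<forall>\<^sub>F x in at_top. T < F_fun A q0 x"
proof -
  define c where "c = q0 / k_l A * sqrt (alpha_l A * pi)"
  let ?m = "sqrt (alpha_s A / alpha_l A)"
  have c: "0 < c" and pos: "0 < gam A * rho A * alpha_l A / k_l A" "0 < ?m"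
    using assms by (auto simp: initially_liquid_alloy_def c_def)
  have "((\<lambda>x. T_0 A - c * exp (- x\<^sup>2)) \<longlongrightarrow> T_0 A - c * 0) at_top"
    by (intro tendsto_intros) real_asymp
  then have "\<forall>\<^sub>F x in at_top. T < T_0 A - c * exp (- x\<^sup>2)"
    using assms(3) by (intro order_tendstoD(1)[of _ "T_0 A"]) auto
  with eventually_gt_at_top[of 0] show ?thesis
  proof eventually_elim
    case (elim x)
    have "c * exp (- x\<^sup>2) * F1_fun (?m * x) \<le> c * exp (- x\<^sup>2) * 1"
      using c pos elim by (intro mult_left_mono F1_fun_le_1) auto
    moreover have "0 < gam A * rho A * alpha_l A / k_l A * Q_fun (?m * x)"
      using pos elim Q_fun_pos[of "?m * x"] by (intro mult_pos_pos) auto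
    ultimately show ?case
      using elim(2) unfolding F_fun_def c_def by linarith
  qed
qed

text \<open>
  Along \<open>T = F_fun A q0 \<lambda>\<close> the convex combination of \<open>f_s A T\<close> and \<open>f_l A T\<close> with weight \<open>Q_fun\<close> on
  the larger value \<open>f_s A T\<close> increases strictly in \<open>\<lambda>\<close>: first move \<open>T\<close> at fixed weight, then move the
  weight. So it takes the value \<open>C_0 A\<close> at most once.
\<close>

lemma coefficient_system_unique:
  assumes A: "initially_liquid_alloy A" and q0: "0 < q0"
    and 1: "coefficient_system A q0 T1 l1" and 2: "coefficient_system A q0 T2 l2"
  shows "T1 = T2 \<and> l1 = l2"
proof -
  have aux: "\<not> la < lb" if a: "coefficient_system A q0 Ta la" and b: "coefficient_system A q0 Tb lb"
    for Ta la Tb lb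
  proof
    assume less: "la < lb"
    note a = a[unfolded coefficient_system_iff[OF A]] and b = b[unfolded coefficient_system_iff[OF A]]
    define Qa Qb where "Qa = Q_fun (sqrt (alpha_s A / d_l A) * la)" and "Qb = Q_fun (sqrt (alpha_s A / d_l A) * lb)"
    have nu: "0 < sqrt (alpha_s A / d_l A)"
      using A by (auto simp: initially_liquid_alloy_def)
    have Q: "0 < Qa" "Qa < 1" "Qa < Qb"
      using a b nu less by (auto simp: Qa_def Qb_def intro!: Q_fun_pos Q_fun_less_1 Q_fun_strict_mono)
    have T: "Ta < Tb"
      using a b F_fun_strict_mono[OF A q0, of la lb] less by auto
    have f: "f_l A Ta < f_l A Tb" "f_s A Ta < f_s A Tb"
      using T a b by (auto simp: f_l_less_iff[OF A] f_s_less_iff[OF A])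
    have pos: "0 < f_s A Tb - f_l A Tb"
      using A b by (auto simp: initially_liquid_alloy_def)
    have a_eq: "(f_s A Ta - f_l A Ta) * Qa = C_0 A - f_l A Ta"
      using a unfolding Qa_def by blast
    have b_eq: "(f_s A Tb - f_l A Tb) * Qb = C_0 A - f_l A Tb"
      using b unfolding Qb_def by blast
    have "C_0 A = Qa * f_s A Ta + (1 - Qa) * f_l A Ta"
      using a_eq by (simp add: algebra_simps)
    also have "\<dots> < Qa * f_s A Tb + (1 - Qa) * f_l A Tb"
      using Q f by (intro add_strict_mono mult_strict_left_mono) auto
    also have "\<dots> = f_l A Tb + (f_s A Tb - f_l A Tb) * Qa"
      by (simp add: algebra_simps)
    also have "\<dots> < f_l A Tb + (f_s A Tb - f_l A Tb) * Qb"
      using Q pos by simp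
    also have "\<dots> = C_0 A"
      using b_eq by simp
    finally show False by simp
  qed
  have "l1 = l2"
    using aux[OF 1 2] aux[OF 2 1] by simp
  with 1 2 show ?thesis
    by (simp add: coefficient_system_def)
qed

text \<open>
  The intermediate value theorem is used twice: for a point \<open>L\<close> at which \<open>F_fun A q0\<close> reaches the
  liquidus temperature \<open>T_0l A\<close>, and then on \<open>{0..L}\<close>, where \<open>F_fun A q0\<close> stays between \<open>T_0s A\<close> and
  \<open>T_0l A\<close> and the phase diagram functions are continuous.
\<close>

lemma coefficient_system_solvable:
  assumes A: "initially_liquid_alloy A" and q0: "0 < q0"
    and lower: "T_0s A < F_fun A q0 0" and upper: "F_fun A q0 0 < T_0l A"
  shows "\<exists>Tk lam. coefficient_system A q0 Tk lam"
proof -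
  note Tl = T_0l_liquidus[OF A] and Ts = T_0s_solidus[OF A]
  let ?F = "F_fun A q0"
  \<comment> \<open>the convex combination \<open>Q * f_s + (1 - Q) * f_l\<close> along \<open>T = F_fun A q0 x\<close>\<close>
  define G where "G = (\<lambda>x. (f_s A (?F x) - f_l A (?F x)) * Q_fun (sqrt (alpha_s A / d_l A) * x)
    + f_l A (?F x))"
  have "T_0l A < T_0 A"
    using f_l_less_iff[OF A, of "T_0l A" "T_0 A"] A Tl by (auto simp: initially_liquid_alloy_def)
  from F_fun_eventually_greater[OF A q0 this]
  obtain N where N: "\<And>x. N \<le> x \<Longrightarrow> T_0l A < ?F x"
    by (auto simp: eventually_at_top_linorder)
  have "\<exists>x\<ge>0. x \<le> max 0 N \<and> ?F x = T_0l A"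
    using upper N[of "max 0 N"] continuous_on_F_fun by (intro IVT') auto
  then obtain L where L: "0 \<le> L" "?F L = T_0l A" by auto
  with upper have L0: "0 < L"
    by (cases "L = 0") auto
  have F_mono: "?F x \<le> ?F y" if "0 \<le> x" "x \<le> y" for x y
    using F_fun_strict_mono[OF A q0 that(1), of y] that by (cases "x = y") auto
  have F_range: "?F x \<in> {T_A A<..<T_B A}" if "0 \<le> x" "x \<le> L" for x
    using F_mono[of 0 x] F_mono[of x L] that lower L Tl Ts by auto
  have cont: "continuous_on {0..L} (\<lambda>x. f (?F x))" if "continuous_on {T_A A..T_B A} f" for f :: "real \<Rightarrow> real"
    using F_range by (intro continuous_on_compose2[OF that continuous_on_F_fun]) force
  have "continuous_on {0..L} (\<lambda>x. f_s A (?F x))" "continuous_on {0..L} (\<lambda>x. f_l A (?F x))"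
    using A by (auto intro!: cont simp: initially_liquid_alloy_def)
  then have contG: "continuous_on {0..L} G"
    unfolding G_def by (intro continuous_intros)
  have G0: "G 0 < C_0 A"
    using f_l_less_iff[OF A, of "?F 0" "T_0l A"] F_range[of 0] L0 Tl upper
    by (simp add: G_def Q_fun_def)
  have "0 < f_s A (T_0l A) - f_l A (T_0l A)"
    using A Tl by (auto simp: initially_liquid_alloy_def)
  moreover have "0 < Q_fun (sqrt (alpha_s A / d_l A) * L)"
    using A L0 by (intro Q_fun_pos) (auto simp: initially_liquid_alloy_def)
  ultimately have GL: "C_0 A < G L"
    using Tl L by (simp add: G_def)
  have "\<exists>x\<ge>0. x \<le> L \<and> G x = C_0 A"
    using G0 GL L0 contG by (intro IVT') auto
  then obtain lam where lam: "0 \<le> lam" "lam \<le> L" "G lam = C_0 A" by auto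
  with G0 have "0 < lam"
    by (cases "lam = 0") auto
  with lam F_range[of lam] have "coefficient_system A q0 (?F lam) lam"
    by (simp add: coefficient_system_iff[OF A] G_def)
  then show ?thesis by blast
qed

section \<open>Similarity profiles of the heat equation\<close>

definition erf_profile :: "real \<Rightarrow> real \<Rightarrow> real \<Rightarrow> real \<Rightarrow> real \<Rightarrow> real" where
  "erf_profile \<kappa> a b x t = a + b * erf (x / (2 * sqrt (\<kappa> * t)))"

text \<open>
  The factor \<open>1 / sqrt t\<close> is split off because it is common to all gradients on a parabolic front and
  to the front speed, so that it cancels in the balance laws.
\<close>

lemma erf_profile_has_derivative:
  assumes "0 < \<kappa>" "0 < t"
  shows "((\<lambda>y. erf_profile \<kappa> a b y t) has_real_derivative
    b / sqrt (pi * \<kappa>) * exp (- (x / (2 * sqrt (\<kappa> * t)))\<^sup>2) / sqrt t) (at x)"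
proof -
  define r where "r = 2 * sqrt (\<kappa> * t)"
  have r: "0 < r" using assms by (simp add: r_def)
  have "((\<lambda>y. y / r) has_real_derivative 1 / r) (at x)"
    by (intro DERIV_cdivide DERIV_ident)
  from DERIV_cmult[OF erf_derivative[OF this], of b]
  have "((\<lambda>y. b * erf (y / r)) has_real_derivative b * (2 / sqrt pi * exp (- (x / r)\<^sup>2) * (1 / r))) (at x)" .
  from DERIV_add[OF DERIV_const[of a] this]
  have "((\<lambda>y. a + b * erf (y / r)) has_real_derivative b * (2 / sqrt pi * exp (- (x / r)\<^sup>2) * (1 / r))) (at x)"
    by simp
  moreover have "b * (2 / sqrt pi * e * (1 / r)) = b / sqrt (pi * \<kappa>) * e / sqrt t" for e
    by (simp add: r_def real_sqrt_mult)
  ultimately show ?thesis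
    unfolding erf_profile_def r_def by (simp only:)
qed

lemma dx_erf_profile:
  assumes "0 < \<kappa>" "0 < t"
  shows "dx (erf_profile \<kappa> a b) x t
    = b / sqrt (pi * \<kappa>) * exp (- (x / (2 * sqrt (\<kappa> * t)))\<^sup>2) / sqrt t"
  unfolding dx_def by (rule DERIV_imp_deriv[OF erf_profile_has_derivative[OF assms]])

lemma heat_equation_erf_profile:
  assumes \<kappa>: "0 < \<kappa>" and R: "\<And>x t. (x, t) \<in> R \<Longrightarrow> 0 < t"
  shows "heat_equation \<kappa> R (erf_profile \<kappa> a b)"
  unfolding heat_equation_def
proof (intro ballI, clarify)
  fix x t assume "(x, t) \<in> R"
  then have t: "0 < t" by (rule R)
  define E where "E = exp (- (x / (2 * sqrt (\<kappa> * t)))\<^sup>2)"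
  have dx_eq: "(\<lambda>y. dx (erf_profile \<kappa> a b) y t)
      = (\<lambda>y. b / sqrt (pi * \<kappa>) * exp (- (y / (2 * sqrt (\<kappa> * t)))\<^sup>2) / sqrt t)"
    using dx_erf_profile[OF \<kappa> t] by auto
  define r where "r = sqrt (\<kappa> * t)"
  have r: "0 < r" "\<kappa> * t = r * r"
    using \<kappa> t mult_pos_pos[OF \<kappa> t] by (auto simp: r_def)
  have "((\<lambda>y. exp (- (y / (2 * r))\<^sup>2)) has_real_derivative E * (- (x / (2 * (r * r))))) (at x)"
    using r(1) by (auto intro!: derivative_eq_intros simp: E_def r_def[symmetric] field_simps power2_eq_square)
  then have "((\<lambda>y. b / sqrt (pi * \<kappa>) * exp (- (y / (2 * r))\<^sup>2) / sqrt t) has_real_derivative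
      b / sqrt (pi * \<kappa>) * (E * (- (x / (2 * (r * r))))) / sqrt t) (at x)"
    by (intro DERIV_cdivide DERIV_cmult)
  then have xx: "((\<lambda>y. dx (erf_profile \<kappa> a b) y t) has_real_derivative
      b / sqrt (pi * \<kappa>) * (E * (- (x / (2 * (r * r))))) / sqrt t) (at x)"
    unfolding dx_eq r_def .
  have "((\<lambda>\<tau>. sqrt (\<kappa> * \<tau>)) has_real_derivative \<kappa> * (inverse r / 2)) (at t)"
    using mult_pos_pos[OF \<kappa> t] by (auto intro!: derivative_eq_intros simp: r_def)
  then have dr: "((\<lambda>\<tau>. sqrt (\<kappa> * \<tau>)) has_real_derivative r / (2 * t)) (at t)"
    by (rule DERIV_cong) (use r t in \<open>simp add: field_simps\<close>)
  have inner: "((\<lambda>\<tau>. x / (2 * sqrt (\<kappa> * \<tau>))) has_real_derivative - (x / (4 * t * r))) (at t)"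
    using DERIV_divide[OF DERIV_const[of x] DERIV_cmult[OF dr, of 2]] r(1) t
    by (simp add: r_def[symmetric] field_simps)
  have tt: "((\<lambda>\<tau>. erf_profile \<kappa> a b x \<tau>) has_real_derivative
      b * (2 / sqrt pi * E * (- (x / (4 * t * r))))) (at t)"
    unfolding erf_profile_def E_def
    by (rule derivative_eq_intros refl inner)+ simp
  have "sqrt (pi * \<kappa>) * sqrt t = sqrt pi * r"
    by (simp add: r_def real_sqrt_mult)
  moreover have "\<kappa> = r * r / t"
    using r(2) t by (simp add: field_simps)
  ultimately have "\<kappa> * (b / sqrt (pi * \<kappa>) * (E * (- (x / (2 * (r * r))))) / sqrt t)
      = r * r / t * (b * (E * (- (x / (2 * (r * r))))) / (sqrt pi * r))"
    by (metis (no_types, lifting) divide_divide_eq_left times_divide_eq_left)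
  also have "\<dots> = b * (2 / sqrt pi * E * (- (x / (4 * t * r))))"
    using r(1) t by (simp add: divide_simps)
  finally have "\<kappa> * (b / sqrt (pi * \<kappa>) * (E * (- (x / (2 * (r * r))))) / sqrt t)
      = b * (2 / sqrt pi * E * (- (x / (4 * t * r))))" .
  with DERIV_imp_deriv[OF xx] DERIV_imp_deriv[OF tt]
  have "\<kappa> * dx (dx (erf_profile \<kappa> a b)) x t = dt (erf_profile \<kappa> a b) x t"
    by (simp add: dx_def[of "dx (erf_profile \<kappa> a b)"] dt_def)
  then show "(\<lambda>y. erf_profile \<kappa> a b y t) differentiable at x
      \<and> (\<lambda>y. dx (erf_profile \<kappa> a b) y t) differentiable at x
      \<and> (\<lambda>\<tau>. erf_profile \<kappa> a b x \<tau>) differentiable at t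
      \<and> \<kappa> * dx (dx (erf_profile \<kappa> a b)) x t = dt (erf_profile \<kappa> a b) x t"
    using erf_profile_has_derivative[OF \<kappa> t] xx tt
    unfolding real_differentiable_def by blast
qed

lemma isCont_erf_profile:
  assumes "0 < \<kappa>" "0 < t"
  shows "isCont (\<lambda>x. erf_profile \<kappa> a b x t) x"
  using erf_profile_has_derivative[OF assms] DERIV_isCont by blast

lemma isCont_dx_erf_profile:
  assumes "0 < \<kappa>" "0 < t"
  shows "isCont (\<lambda>x. dx (erf_profile \<kappa> a b) x t) x"
  using assms by (simp add: dx_erf_profile)

lemma dx_cong:
  assumes "open S" "x \<in> S" "\<And>y. y \<in> S \<Longrightarrow> v y t = w y t"
  shows "dx v x t = dx w x t"
  unfolding dx_def using assms by (intro deriv_cong_ev) (auto simp: eventually_nhds)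

text \<open>
  The unknowns are controlled only inside their regions, so boundary values are one-sided limits of
  a function that agrees there with a continuous one.
\<close>

lemma tendsto_boundary:
  fixes l r :: real
  assumes "l < r" "\<And>x. isCont g x" "\<And>x. x \<in> {l<..<r} \<Longrightarrow> f x = (g x :: real)"
  shows "(f \<longlongrightarrow> g l) (at_right l)" "(f \<longlongrightarrow> g r) (at_left r)"
proof -
  have "(g \<longlongrightarrow> g l) (at_right l)" "(g \<longlongrightarrow> g r) (at_left r)"
    using assms(2) by (auto simp: isCont_def intro: tendsto_within_subset)
  moreover have "\<forall>\<^sub>F x in at_right l. g x = f x"
    using assms by (auto intro!: eventually_at_rightI[of l r])
  moreover have "\<forall>\<^sub>F x in at_left r. g x = f x"
    using assms by (auto intro!: eventually_at_leftI[of l r])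
  ultimately show "(f \<longlongrightarrow> g l) (at_right l)" "(f \<longlongrightarrow> g r) (at_left r)"
    by (auto intro: Lim_transform_eventually)
qed

lemma erf_profile_boundary:
  assumes \<kappa>: "0 < \<kappa>" "0 < t" and "l < r"
    and v: "\<And>x. x \<in> {l<..<r} \<Longrightarrow> v x t = erf_profile \<kappa> a b x t"
  shows "((\<lambda>x. v x t) \<longlongrightarrow> erf_profile \<kappa> a b l t) (at_right l)"
    and "((\<lambda>x. v x t) \<longlongrightarrow> erf_profile \<kappa> a b r t) (at_left r)"
    and "((\<lambda>x. dx v x t) \<longlongrightarrow> dx (erf_profile \<kappa> a b) l t) (at_right l)"
    and "((\<lambda>x. dx v x t) \<longlongrightarrow> dx (erf_profile \<kappa> a b) r t) (at_left r)"
proof -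
  have "dx v x t = dx (erf_profile \<kappa> a b) x t" if "x \<in> {l<..<r}" for x
    using that v by (intro dx_cong[of "{l<..<r}"]) auto
  note * = tendsto_boundary[OF \<open>l < r\<close> isCont_erf_profile[OF \<kappa>] v]
    tendsto_boundary[OF \<open>l < r\<close> isCont_dx_erf_profile[OF \<kappa>] this]
  then show "((\<lambda>x. v x t) \<longlongrightarrow> erf_profile \<kappa> a b l t) (at_right l)"
    and "((\<lambda>x. v x t) \<longlongrightarrow> erf_profile \<kappa> a b r t) (at_left r)"
    and "((\<lambda>x. dx v x t) \<longlongrightarrow> dx (erf_profile \<kappa> a b) l t) (at_right l)"
    and "((\<lambda>x. dx v x t) \<longlongrightarrow> dx (erf_profile \<kappa> a b) r t) (at_left r)"
    by blast+
qed

lemma tendsto_erf_profile_at_top: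
  assumes "filterlim (\<lambda>z. x z / (2 * sqrt (\<kappa> * t z))) at_top F"
  shows "((\<lambda>z. erf_profile \<kappa> a b (x z) (t z)) \<longlongrightarrow> a + b) F"
proof -
  have "((\<lambda>z. a + b * erf (x z / (2 * sqrt (\<kappa> * t z)))) \<longlongrightarrow> a + b * 1) F"
    by (intro tendsto_intros filterlim_compose[OF erf_tendsto_1 assms])
  then show ?thesis by (simp add: erf_profile_def)
qed

lemma erf_profile_tendsto_infinity:
  assumes "0 < \<kappa>" "0 < t"
    and "\<And>x. l < x \<Longrightarrow> v x t = erf_profile \<kappa> a b x t"
  shows "((\<lambda>x. v x t) \<longlongrightarrow> a + b) at_top"
proof (rule Lim_transform_eventually)
  define c where "c = 2 * sqrt (\<kappa> * t)"
  have "0 < c" using assms(1,2) by (simp add: c_def)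
  then have "filterlim (\<lambda>x. x / c) at_top at_top"
    by real_asymp
  then show "((\<lambda>x. erf_profile \<kappa> a b x t) \<longlongrightarrow> a + b) at_top"
    unfolding c_def by (rule tendsto_erf_profile_at_top)
  show "\<forall>\<^sub>F x in at_top. erf_profile \<kappa> a b x t = v x t"
    using eventually_gt_at_top[of l] by eventually_elim (simp add: assms)
qed

text \<open>
  For \<open>t\<close> tending to \<open>0\<close> and fixed \<open>x > 0\<close>, the similarity variable tends to infinity and the front
  tends to \<open>0\<close>, so \<open>x\<close> enters the liquid region. The initial value therefore equals the limit at
  infinity.
\<close>

lemma erf_profile_initial_value:
  assumes \<kappa>: "0 < \<kappa>"
    and front: "\<And>t. 0 < t \<Longrightarrow> front u t = 2 * lam * sqrt (\<alpha> * t)"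
    and v: "\<And>x t. (x, t) \<in> liquid_region u \<Longrightarrow> v x t = erf_profile \<kappa> a b x t"
  shows "initial_value u v c \<longleftrightarrow> c = a + b"
proof -
  have region: "\<forall>\<^sub>F t in at_right 0. (x, t) \<in> liquid_region u" if "0 < x" for x
  proof -
    have "((\<lambda>t. 2 * lam * sqrt (\<alpha> * t)) \<longlongrightarrow> 2 * lam * sqrt (\<alpha> * 0)) (at_right 0)"
      by (intro tendsto_intros)
    then have "\<forall>\<^sub>F t in at_right 0. 2 * lam * sqrt (\<alpha> * t) < x"
      using that by (intro order_tendstoD) auto
    with eventually_at_right_less show ?thesis
      by eventually_elim (simp add: liquid_region_def front)
  qed
  have lim: "((\<lambda>t. v x t) \<longlongrightarrow> a + b) (at_right 0)" if "0 < x" for x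
  proof (rule Lim_transform_eventually)
    have "filterlim (\<lambda>t. x / (2 * sqrt (\<kappa> * t))) at_top (at_right 0)"
      using that \<kappa> by real_asymp
    then show "((\<lambda>t. erf_profile \<kappa> a b x t) \<longlongrightarrow> a + b) (at_right 0)"
      by (rule tendsto_erf_profile_at_top)
    show "\<forall>\<^sub>F t in at_right 0. erf_profile \<kappa> a b x t = v x t"
      using region[OF that] by eventually_elim (simp add: v)
  qed
  have "c = a + b" if "initial_value u v c"
  proof -
    have "((\<lambda>t. v 1 t) \<longlongrightarrow> c) (at_right 0)"
      using that by (auto simp: initial_value_def)
    from tendsto_unique[OF _ this lim[of 1]] show ?thesis by simp
  qed
  then show ?thesis
    using region lim by (auto simp: initial_value_def)
qed

lemma similarity_variable_front:
  assumes "0 < \<alpha>" "0 < \<kappa>" "0 < t"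
  shows "2 * lam * sqrt (\<alpha> * t) / (2 * sqrt (\<kappa> * t)) = sqrt (\<alpha> / \<kappa>) * lam"
  using assms by (simp add: real_sqrt_mult real_sqrt_divide)

text \<open>
  For a function whose limit is known, the claim that it tends to \<open>c\<close> is an equation for \<open>c\<close>. This
  converts each boundary condition into an algebraic one.
\<close>

lemma tendsto_iff_limit_eq:
  assumes "(f \<longlongrightarrow> L) F" "F \<noteq> bot"
  shows "(f \<longlongrightarrow> c) F \<longleftrightarrow> c = (L :: real)"
proof
  show "c = L" if "(f \<longlongrightarrow> c) F"
    by (rule tendsto_unique[OF assms(2) that assms(1)])
  show "(f \<longlongrightarrow> c) F" if "c = L"
    unfolding that by (rule assms(1))
qed

lemma ex_limits_iff:
  fixes L M :: real
  assumes "(f \<longlongrightarrow> L) F" "F \<noteq> bot" "(g \<longlongrightarrow> M) G" "G \<noteq> bot"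
  shows "(\<exists>a b. (f \<longlongrightarrow> a) F \<and> (g \<longlongrightarrow> b) G \<and> P a b) \<longleftrightarrow> P L M"
  by (simp add: tendsto_iff_limit_eq[OF assms(1,2)] tendsto_iff_limit_eq[OF assms(3,4)])

lemma all_pos_const_iff: "(\<forall>t::real>0. P) \<longleftrightarrow> P"
  by (metis zero_less_one)

section \<open>The boundary conditions on a parabolic front\<close>

text \<open>
  On the front \<open>2 * lam * sqrt (alpha_s A * t)\<close> the similarity variable of diffusivity \<open>\<kappa>\<close> has the
  constant value \<open>sqrt (alpha_s A / \<kappa>) * lam\<close>, abbreviated \<open>\<mu> * lam\<close>, \<open>\<nu> * lam\<close> and \<open>\<sigma> * lam\<close>. Hence
  each condition either does not involve \<open>t\<close> or has the factor \<open>1 / sqrt t\<close> on both sides, and asking it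
  for all \<open>t > 0\<close> is asking one equation. The initial condition and the condition at infinity coincide.
\<close>

lemma solves_P1_iff:
  fixes A u lam
  defines "\<mu> \<equiv> sqrt (alpha_s A / alpha_l A)" and "\<nu> \<equiv> sqrt (alpha_s A / d_l A)"
    and "\<sigma> \<equiv> sqrt (alpha_s A / d_s A)"
  assumes A: "initially_liquid_alloy A" and lam: "0 < lam"
    and front: "\<forall>t>0. front u t = 2 * lam * sqrt (alpha_s A * t)"
    and Ts: "\<forall>(x, t) \<in> solid_region u. temp_s u x t = erf_profile (alpha_s A) a1 b1 x t"
    and Tl: "\<forall>(x, t) \<in> liquid_region u. temp_l u x t = erf_profile (alpha_l A) a2 b2 x t"
    and Cs: "\<forall>(x, t) \<in> solid_region u. conc_s u x t = erf_profile (d_s A) a3 b3 x t"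
    and Cl: "\<forall>(x, t) \<in> liquid_region u. conc_l u x t = erf_profile (d_l A) a4 b4 x t"
  shows "solves_P1 A q0 u \<longleftrightarrow>
     T_A A < temp_k u \<and> temp_k u < T_B A \<and>
     heat_equation (alpha_s A) (solid_region u) (temp_s u) \<and>
     heat_equation (alpha_l A) (liquid_region u) (temp_l u) \<and>
     heat_equation (d_s A) (solid_region u) (conc_s u) \<and>
     heat_equation (d_l A) (liquid_region u) (conc_l u) \<and>
     k_s A * b1 = q0 * sqrt (pi * alpha_s A) \<and>
     a1 + b1 * erf lam = temp_k u \<and>
     a2 + b2 * erf (\<mu> * lam) = temp_k u \<and>
     a2 + b2 = T_0 A \<and>
     b3 = 0 \<and>
     a3 + b3 * erf (\<sigma> * lam) = f_s A (temp_k u) \<and>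
     a4 + b4 = C_0 A \<and>
     a4 + b4 * erf (\<nu> * lam) = f_l A (temp_k u) \<and>
     k_s A * (b1 / sqrt (pi * alpha_s A) * exp (- lam\<^sup>2))
       - k_l A * (b2 / sqrt (pi * alpha_l A) * exp (- (\<mu> * lam)\<^sup>2)) = gam A * rho A * (lam * sqrt (alpha_s A)) \<and>
     d_l A * (b4 / sqrt (pi * d_l A) * exp (- (\<nu> * lam)\<^sup>2))
       - d_s A * (b3 / sqrt (pi * d_s A) * exp (- (\<sigma> * lam)\<^sup>2))
       = (f_s A (temp_k u) - f_l A (temp_k u)) * (lam * sqrt (alpha_s A))"
proof -
  have front: "front u t = 2 * lam * sqrt (alpha_s A * t)" if "0 < t" for t
    using front that by blast
  have Ts: "temp_s u x t = erf_profile (alpha_s A) a1 b1 x t"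
    and Cs: "conc_s u x t = erf_profile (d_s A) a3 b3 x t" if "(x, t) \<in> solid_region u" for x t
    using Ts Cs that by auto
  have Tl: "temp_l u x t = erf_profile (alpha_l A) a2 b2 x t"
    and Cl: "conc_l u x t = erf_profile (d_l A) a4 b4 x t" if "(x, t) \<in> liquid_region u" for x t
    using Tl Cl that by auto
  have pos: "0 < alpha_s A" "0 < alpha_l A" "0 < d_s A" "0 < d_l A" "0 < k_s A" "0 < k_l A"
    using A by (auto simp: initially_liquid_alloy_def)
  have front_pos: "0 < front u t" if "0 < t" for t
    using that lam pos by (simp add: front)
  have front_deriv: "(front u has_real_derivative lam * sqrt (alpha_s A) / sqrt t) (at t)" if t: "0 < t" for t
  proof (rule DERIV_cong_ev[THEN iffD1, OF refl _ refl])
    show "((\<lambda>t. 2 * lam * sqrt (alpha_s A * t)) has_real_derivative lam * sqrt (alpha_s A) / sqrt t) (at t)"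
      using t pos by (auto intro!: derivative_eq_intros simp: real_sqrt_mult field_simps)
    show "\<forall>\<^sub>F x in nhds t. 2 * lam * sqrt (alpha_s A * x) = front u x"
      using t by (auto simp: eventually_nhds front intro!: exI[of _ "{0<..}"])
  qed
  \<comment> \<open>one-sided limits need only a piece of the unbounded liquid region next to the front, here of
    length \<open>1\<close>\<close>
  note sol = erf_profile_boundary[where l = 0 and r = "front u t" for t, OF _ _ front_pos]
  note liq = erf_profile_boundary[where l = "front u t" and r = "front u t + 1" for t]
  note val = similarity_variable_front[OF pos(1)]
  have Ts': "\<And>x t. 0 < t \<Longrightarrow> x \<in> {0<..<front u t} \<Longrightarrow> temp_s u x t = erf_profile (alpha_s A) a1 b1 x t"
    and Cs': "\<And>x t. 0 < t \<Longrightarrow> x \<in> {0<..<front u t} \<Longrightarrow> conc_s u x t = erf_profile (d_s A) a3 b3 x t"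
    and Tl': "\<And>x t. 0 < t \<Longrightarrow> x \<in> {front u t<..<front u t+1} \<Longrightarrow> temp_l u x t = erf_profile (alpha_l A) a2 b2 x t"
    and Cl': "\<And>x t. 0 < t \<Longrightarrow> x \<in> {front u t<..<front u t+1} \<Longrightarrow> conc_l u x t = erf_profile (d_l A) a4 b4 x t"
    by (auto simp: solid_region_def liquid_region_def intro: Ts Cs Tl Cl)
  have Tl'': "\<And>x t. 0 < t \<Longrightarrow> front u t < x \<Longrightarrow> temp_l u x t = erf_profile (alpha_l A) a2 b2 x t"
    by (auto simp: liquid_region_def intro: Tl)
  have sp: "erf_profile k a b (front u t) t = a + b * erf (sqrt (alpha_s A / k) * lam)" if "0 < k" "0 < t" for k a b t
    using that by (simp add: erf_profile_def front val)
  have dsp: "dx (erf_profile k a b) (front u t) t = (b / sqrt (pi * k) * exp (- (sqrt (alpha_s A / k) * lam)\<^sup>2)) / sqrt t"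
    if "0 < k" "0 < t" for k a b t
    using that by (simp add: dx_erf_profile front val)
  have v: "((\<lambda>x. k_s A * dx (temp_s u) x t) \<longlongrightarrow> q0 / sqrt t) (at_right 0) \<longleftrightarrow> k_s A * b1 = q0 * sqrt (pi * alpha_s A)"
    if "0 < t" for t
  proof -
    have "((\<lambda>x. k_s A * dx (temp_s u) x t) \<longlongrightarrow> k_s A * dx (erf_profile (alpha_s A) a1 b1) 0 t) (at_right 0)"
      using that pos by (intro tendsto_mult tendsto_const sol Ts') auto
    then have "((\<lambda>x. k_s A * dx (temp_s u) x t) \<longlongrightarrow> q0 / sqrt t) (at_right 0) \<longleftrightarrow>
      q0 / sqrt t = k_s A * dx (erf_profile (alpha_s A) a1 b1) 0 t"
      by (rule tendsto_iff_limit_eq) simp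
    also have "\<dots> \<longleftrightarrow> k_s A * b1 = q0 * sqrt (pi * alpha_s A)"
      using that pos by (auto simp: dx_erf_profile field_simps)
    finally show ?thesis .
  qed
  have vi: "((\<lambda>x. temp_s u x t) \<longlongrightarrow> c) (at_left (front u t)) \<longleftrightarrow> a1 + b1 * erf lam = c" if "0 < t" for t c
    by (subst tendsto_iff_limit_eq[OF sol(2)[OF _ _ _ Ts']]) (use that pos sp[of "alpha_s A" t] in auto)
  have vi': "((\<lambda>x. temp_l u x t) \<longlongrightarrow> c) (at_right (front u t)) \<longleftrightarrow> a2 + b2 * erf (\<mu> * lam) = c" if "0 < t" for t c
    by (subst tendsto_iff_limit_eq[OF liq(1)[OF _ _ _ Tl']]) (use that pos sp[of "alpha_l A" t] in \<open>auto simp: \<mu>_def\<close>)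
  have vii: "initial_value u (temp_l u) c \<longleftrightarrow> a2 + b2 = c" for c
    by (subst erf_profile_initial_value[OF pos(2) front Tl]) auto
  have viii: "((\<lambda>x. temp_l u x t) \<longlongrightarrow> c) at_top \<longleftrightarrow> a2 + b2 = c" if "0 < t" for t c
    by (subst tendsto_iff_limit_eq[OF erf_profile_tendsto_infinity[where v = "temp_l u" and l = "front u t", OF pos(2) that Tl''[OF that]]]) auto
  have ix: "((\<lambda>x. dx (conc_s u) x t) \<longlongrightarrow> 0) (at_right 0) \<longleftrightarrow> b3 = 0" if "0 < t" for t
    by (subst tendsto_iff_limit_eq[OF sol(3)[OF _ _ _ Cs']]) (use that pos in \<open>auto simp: dx_erf_profile\<close>)
  have x: "((\<lambda>x. conc_s u x t) \<longlongrightarrow> c) (at_left (front u t)) \<longleftrightarrow> a3 + b3 * erf (\<sigma> * lam) = c" if "0 < t" for t c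
    by (subst tendsto_iff_limit_eq[OF sol(2)[OF _ _ _ Cs']]) (use that pos sp[of "d_s A" t] in \<open>auto simp: \<sigma>_def\<close>)
  have xi: "initial_value u (conc_l u) c \<longleftrightarrow> a4 + b4 = c" for c
    by (subst erf_profile_initial_value[OF pos(4) front Cl]) auto
  have xii: "((\<lambda>x. conc_l u x t) \<longlongrightarrow> c) (at_right (front u t)) \<longleftrightarrow> a4 + b4 * erf (\<nu> * lam) = c" if "0 < t" for t c
    by (subst tendsto_iff_limit_eq[OF liq(1)[OF _ _ _ Cl']]) (use that pos sp[of "d_l A" t] in \<open>auto simp: \<nu>_def\<close>)
  have balance: "k * (c / sqrt t) - k' * (c' / sqrt t) = h * deriv (front u) t \<longleftrightarrow>
      k * c - k' * c' = h * (lam * sqrt (alpha_s A))" if "0 < t" for k k' c c' h t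
    unfolding DERIV_imp_deriv[OF front_deriv[OF that]] using that by (simp add: field_simps)
  have xiii: "(\<exists>a b. ((\<lambda>x. dx (temp_s u) x t) \<longlongrightarrow> a) (at_left (front u t)) \<and>
        ((\<lambda>x. dx (temp_l u) x t) \<longlongrightarrow> b) (at_right (front u t)) \<and>
        k_s A * a - k_l A * b = gam A * rho A * deriv (front u) t) \<longleftrightarrow>
      k_s A * (b1 / sqrt (pi * alpha_s A) * exp (- lam\<^sup>2))
       - k_l A * (b2 / sqrt (pi * alpha_l A) * exp (- (\<mu> * lam)\<^sup>2)) = gam A * rho A * (lam * sqrt (alpha_s A))"
    (is "?L \<longleftrightarrow> ?R") if "0 < t" for t
  proof -
    have "?L \<longleftrightarrow> k_s A * dx (erf_profile (alpha_s A) a1 b1) (front u t) t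
        - k_l A * dx (erf_profile (alpha_l A) a2 b2) (front u t) t = gam A * rho A * deriv (front u) t"
      by (rule ex_limits_iff[OF sol(4)[OF _ _ _ Ts'] _ liq(3)[OF _ _ _ Tl']]) (use that pos in auto)
    also have "\<dots> \<longleftrightarrow> k_s A * (b1 / sqrt (pi * alpha_s A) * exp (- (sqrt (alpha_s A / alpha_s A) * lam)\<^sup>2))
       - k_l A * (b2 / sqrt (pi * alpha_l A) * exp (- (\<mu> * lam)\<^sup>2)) = gam A * rho A * (lam * sqrt (alpha_s A))"
      unfolding \<mu>_def by (simp only: dsp[OF pos(1) that] dsp[OF pos(2) that] balance[OF that])
    finally show ?thesis
      using pos(1) by simp
  qed
  have xiv: "(\<exists>a b. ((\<lambda>x. dx (conc_l u) x t) \<longlongrightarrow> a) (at_right (front u t)) \<and>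
        ((\<lambda>x. dx (conc_s u) x t) \<longlongrightarrow> b) (at_left (front u t)) \<and>
        d_l A * a - d_s A * b = (f_s A (temp_k u) - f_l A (temp_k u)) * deriv (front u) t) \<longleftrightarrow>
      d_l A * (b4 / sqrt (pi * d_l A) * exp (- (\<nu> * lam)\<^sup>2))
       - d_s A * (b3 / sqrt (pi * d_s A) * exp (- (\<sigma> * lam)\<^sup>2))
       = (f_s A (temp_k u) - f_l A (temp_k u)) * (lam * sqrt (alpha_s A))"
    (is "?L \<longleftrightarrow> ?R") if "0 < t" for t
  proof -
    have "?L \<longleftrightarrow> d_l A * dx (erf_profile (d_l A) a4 b4) (front u t) t
        - d_s A * dx (erf_profile (d_s A) a3 b3) (front u t) t
        = (f_s A (temp_k u) - f_l A (temp_k u)) * deriv (front u) t"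
      by (rule ex_limits_iff[OF liq(3)[OF _ _ _ Cl'] _ sol(4)[OF _ _ _ Cs']]) (use that pos in auto)
    also have "\<dots> \<longleftrightarrow> ?R"
      unfolding \<nu>_def \<sigma>_def by (simp only: dsp[OF pos(3) that] dsp[OF pos(4) that] balance[OF that])
    finally show ?thesis .
  qed
  have i: "\<forall>t>0. front u t > 0 \<and> front u differentiable (at t)"
    using front_pos front_deriv unfolding real_differentiable_def by blast
  show ?thesis
    unfolding solves_P1_def
    by (simp only: v vi vi' vii viii ix x xi xii xiii xiv i simp_thms all_pos_const_iff cong: imp_cong) auto
qed

section \<open>Similarity solutions\<close>

lemma exp_div_erfc: "exp (- x\<^sup>2) / erfc x = 1 / F1_fun x"
  by (simp add: F1_fun_def exp_minus field_simps)

text \<open>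
  With \<open>\<mu> = sqrt (alpha_s A / alpha_l A)\<close>, the liquid gradient at the front is proportional to
  \<open>(T_0 A - Tk) / F1_fun (\<mu> * lam)\<close>, by \<open>exp_div_erfc\<close>. Solving the balance for \<open>Tk\<close> multiplies the latent heat by
  \<open>lam * F1_fun (\<mu> * lam)\<close>, which is the \<open>Q_fun\<close> term of \<open>F_fun\<close>, and the flux by
  \<open>F1_fun (\<mu> * lam)\<close>, which is its last term.
\<close>

lemma heat_balance_iff:
  assumes "initially_liquid_alloy A"
  shows "q0 * exp (- lam\<^sup>2)
      - k_l A * ((T_0 A - Tk) / erfc (sqrt (alpha_s A / alpha_l A) * lam) / sqrt (pi * alpha_l A)
          * exp (- (sqrt (alpha_s A / alpha_l A) * lam)\<^sup>2))
      = gam A * rho A * (lam * sqrt (alpha_s A))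
    \<longleftrightarrow> Tk = F_fun A q0 lam"
proof -
  define s r f where "s = sqrt (alpha_l A)" and "r = sqrt (alpha_s A)"
    and "f = F1_fun (sqrt (alpha_s A / alpha_l A) * lam)"
  have s: "0 < s" "alpha_l A = s * s" and k: "0 < k_l A" and f: "0 < f"
    using assms F1_fun_pos by (auto simp: initially_liquid_alloy_def s_def f_def)
  have "(T_0 A - Tk) / erfc (sqrt (alpha_s A / alpha_l A) * lam) / sqrt (pi * alpha_l A)
        * exp (- (sqrt (alpha_s A / alpha_l A) * lam)\<^sup>2)
      = (T_0 A - Tk) / sqrt (pi * alpha_l A) * (exp (- (sqrt (alpha_s A / alpha_l A) * lam)\<^sup>2)
        / erfc (sqrt (alpha_s A / alpha_l A) * lam))"
    by simp
  also have "\<dots> = (T_0 A - Tk) / (sqrt pi * s * f)"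
    unfolding exp_div_erfc by (simp add: f_def s_def real_sqrt_mult)
  finally have flux: "(T_0 A - Tk) / erfc (sqrt (alpha_s A / alpha_l A) * lam) / sqrt (pi * alpha_l A)
        * exp (- (sqrt (alpha_s A / alpha_l A) * lam)\<^sup>2) = (T_0 A - Tk) / (sqrt pi * s * f)" .
  have F: "F_fun A q0 lam = T_0 A + gam A * rho A * (s * s) / k_l A * (sqrt pi * (r / s * lam) * f)
      - q0 / k_l A * (s * sqrt pi) * exp (- lam\<^sup>2) * f"
    unfolding F_fun_def Q_fun_eq f_def[symmetric]
    by (simp add: s(2)[symmetric]) (simp add: s_def r_def real_sqrt_mult real_sqrt_divide)
  define P where "P = sqrt pi * s * f"
  have P: "0 < P"
    using s(1) f by (simp add: P_def)
  have F': "F_fun A q0 lam = T_0 A + (gam A * rho A * (lam * r) - q0 * exp (- lam\<^sup>2)) * P / k_l A"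
    unfolding F P_def using s(1) by (simp add: diff_divide_distrib left_diff_distrib right_diff_distrib mult_ac)
  have "h - k * (T - T') / P = g \<longleftrightarrow> T' = T + (g - h) * P / k" if "0 < k" for h k g T T' :: real
    using that P by (auto simp: field_simps)
  from this[OF k, of "q0 * exp (- lam\<^sup>2)" "T_0 A" Tk "gam A * rho A * (lam * r)"]
  show ?thesis
    unfolding flux F' P_def[symmetric] r_def[symmetric] by simp
qed

text \<open>
  The same computation for the solute; \<open>D\<close> stands for the concentration jump at the front.
\<close>

lemma solute_balance_iff:
  assumes "initially_liquid_alloy A"
  shows "d_l A * ((C_0 A - c) / erfc (sqrt (alpha_s A / d_l A) * lam) / sqrt (pi * d_l A)
          * exp (- (sqrt (alpha_s A / d_l A) * lam)\<^sup>2))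
      = D * (lam * sqrt (alpha_s A))
    \<longleftrightarrow> D * Q_fun (sqrt (alpha_s A / d_l A) * lam) = C_0 A - c"
proof -
  define s r f where "s = sqrt (d_l A)" and "r = sqrt (alpha_s A)"
    and "f = F1_fun (sqrt (alpha_s A / d_l A) * lam)"
  have s: "0 < s" "d_l A = s * s" and f: "0 < f"
    using assms F1_fun_pos by (auto simp: initially_liquid_alloy_def s_def f_def)
  have "(C_0 A - c) / erfc (sqrt (alpha_s A / d_l A) * lam) / sqrt (pi * d_l A)
        * exp (- (sqrt (alpha_s A / d_l A) * lam)\<^sup>2)
      = (C_0 A - c) / sqrt (pi * d_l A) * (exp (- (sqrt (alpha_s A / d_l A) * lam)\<^sup>2)
        / erfc (sqrt (alpha_s A / d_l A) * lam))"
    by simp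
  also have "\<dots> = (C_0 A - c) / (sqrt pi * s * f)"
    unfolding exp_div_erfc by (simp add: f_def s_def real_sqrt_mult)
  finally have flux: "(C_0 A - c) / erfc (sqrt (alpha_s A / d_l A) * lam) / sqrt (pi * d_l A)
        * exp (- (sqrt (alpha_s A / d_l A) * lam)\<^sup>2) = (C_0 A - c) / (sqrt pi * s * f)" .
  have Q: "Q_fun (sqrt (alpha_s A / d_l A) * lam) = sqrt pi * (r / s * lam) * f"
    by (simp add: Q_fun_eq f_def r_def s_def real_sqrt_divide)
  have "s * s * (C / (p * s * f)) = D * (lam * r) \<longleftrightarrow> D * (p * (r / s * lam) * f) = C"
    if "0 < p" for C p :: real
    using that s(1) f by (auto simp: field_simps)
  from this[of "sqrt pi" "C_0 A - c"] show ?thesis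
    unfolding flux Q r_def[symmetric] by (simp add: s(2))
qed

text \<open>
  Seven conditions are linear in the coefficients and \<open>b3 = 0\<close> stands alone; as
  \<open>erfc = 1 - erf > 0\<close>, they can be solved uniquely. With the solutions inserted, the two balance laws
  are \<open>heat_balance_iff\<close> and \<open>solute_balance_iff\<close>.
\<close>

lemma profile_coefficients_iff:
  fixes A lam
  defines "\<mu> \<equiv> sqrt (alpha_s A / alpha_l A)" and "\<nu> \<equiv> sqrt (alpha_s A / d_l A)"
    and "\<sigma> \<equiv> sqrt (alpha_s A / d_s A)"
  assumes A: "initially_liquid_alloy A" and lam: "0 < lam"
  shows "T_A A < Tk \<and> Tk < T_B A \<and>
     k_s A * b1 = q0 * sqrt (pi * alpha_s A) \<and>
     a1 + b1 * erf lam = Tk \<and>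
     a2 + b2 * erf (\<mu> * lam) = Tk \<and>
     a2 + b2 = T_0 A \<and>
     b3 = 0 \<and>
     a3 + b3 * erf (\<sigma> * lam) = f_s A Tk \<and>
     a4 + b4 = C_0 A \<and>
     a4 + b4 * erf (\<nu> * lam) = f_l A Tk \<and>
     k_s A * (b1 / sqrt (pi * alpha_s A) * exp (- lam\<^sup>2))
       - k_l A * (b2 / sqrt (pi * alpha_l A) * exp (- (\<mu> * lam)\<^sup>2)) = gam A * rho A * (lam * sqrt (alpha_s A)) \<and>
     d_l A * (b4 / sqrt (pi * d_l A) * exp (- (\<nu> * lam)\<^sup>2))
       - d_s A * (b3 / sqrt (pi * d_s A) * exp (- (\<sigma> * lam)\<^sup>2))
       = (f_s A Tk - f_l A Tk) * (lam * sqrt (alpha_s A))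
   \<longleftrightarrow>
     coefficient_system A q0 Tk lam \<and>
     b1 = q0 / k_s A * sqrt (pi * alpha_s A) \<and> a1 = Tk - b1 * erf lam \<and>
     b2 = (T_0 A - Tk) / erfc (\<mu> * lam) \<and> a2 = T_0 A - b2 \<and>
     b3 = 0 \<and> a3 = f_s A Tk \<and>
     b4 = (C_0 A - f_l A Tk) / erfc (\<nu> * lam) \<and> a4 = C_0 A - b4"
proof -
  have pos: "0 < alpha_s A" "0 < k_s A"
    using A by (auto simp: initially_liquid_alloy_def)
  have Ts: "k_s A * b1 = q0 * sqrt (pi * alpha_s A) \<longleftrightarrow> b1 = q0 / k_s A * sqrt (pi * alpha_s A)"
    using pos by (auto simp: field_simps)
  have Ts': "a1 + b1 * erf lam = Tk \<longleftrightarrow> a1 = Tk - b1 * erf lam"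
    by auto
  have liq: "a + b * erf z = c \<and> a + b = d \<longleftrightarrow> b = (d - c) / erfc z \<and> a = d - b" for a b c d z
  proof -
    have "a + b * erf z = c \<and> a + b = d \<longleftrightarrow> b * erfc z = d - c \<and> a = d - b"
      by (auto simp: erfc_def algebra_simps)
    then show ?thesis
      using erfc_pos[of z] by (simp add: field_simps)
  qed
  have Cs: "b3 = 0 \<and> a3 + b3 * erf (\<sigma> * lam) = f_s A Tk \<longleftrightarrow> b3 = 0 \<and> a3 = f_s A Tk"
    by auto
  have heat: "k_s A * (b1 / sqrt (pi * alpha_s A) * exp (- lam\<^sup>2))
       - k_l A * (b2 / sqrt (pi * alpha_l A) * exp (- (\<mu> * lam)\<^sup>2)) = gam A * rho A * (lam * sqrt (alpha_s A))
       \<longleftrightarrow> Tk = F_fun A q0 lam"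
    if "b1 = q0 / k_s A * sqrt (pi * alpha_s A)" "b2 = (T_0 A - Tk) / erfc (\<mu> * lam)"
  proof -
    have "k_s A * (b1 / sqrt (pi * alpha_s A) * exp (- lam\<^sup>2)) = q0 * exp (- lam\<^sup>2)"
      using that(1) pos by simp
    then show ?thesis
      unfolding that(2) \<mu>_def by (simp only: heat_balance_iff[OF A])
  qed
  have solute: "d_l A * (b4 / sqrt (pi * d_l A) * exp (- (\<nu> * lam)\<^sup>2))
       - d_s A * (b3 / sqrt (pi * d_s A) * exp (- (\<sigma> * lam)\<^sup>2))
       = (f_s A Tk - f_l A Tk) * (lam * sqrt (alpha_s A))
       \<longleftrightarrow> (f_s A Tk - f_l A Tk) * Q_fun (\<nu> * lam) = C_0 A - f_l A Tk"
    if "b3 = 0" "b4 = (C_0 A - f_l A Tk) / erfc (\<nu> * lam)"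
  proof -
    have "d_s A * (b3 / sqrt (pi * d_s A) * exp (- (\<sigma> * lam)\<^sup>2)) = 0"
      using that(1) by simp
    then show ?thesis
      unfolding that(2) \<nu>_def by (simp only: solute_balance_iff[OF A] diff_zero)
  qed
  show ?thesis
    unfolding Ts Ts' coefficient_system_iff[OF A] \<nu>_def[symmetric]
    using liq[of a2 b2 "\<mu> * lam" Tk "T_0 A"] liq[of a4 b4 "\<nu> * lam" "f_l A Tk" "C_0 A"] Cs heat solute lam
    by satx
qed

lemma similarity_form_iff:
  "similarity_form \<kappa> R v \<longleftrightarrow> (\<exists>a b. \<forall>(x, t) \<in> R. v x t = erf_profile \<kappa> a b x t)"
  by (simp add: similarity_form_def erf_profile_def)

text \<open>
  The explicit state in terms of profiles: \<open>erfc = 1 - erf\<close> brings \<open>conc_l\<close> to the required form, and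
  \<open>conc_s\<close> is a profile with vanishing amplitude.
\<close>

lemma explicit_state_erf_profile:
  "front (explicit_state A q0 Tk lam) t = 2 * lam * sqrt (alpha_s A * t)"
  "temp_k (explicit_state A q0 Tk lam) = Tk"
  "temp_s (explicit_state A q0 Tk lam)
    = erf_profile (alpha_s A) (Tk - q0 / k_s A * sqrt (pi * alpha_s A) * erf lam) (q0 / k_s A * sqrt (pi * alpha_s A))"
  "temp_l (explicit_state A q0 Tk lam)
    = erf_profile (alpha_l A) (T_0 A - (T_0 A - Tk) / erfc (sqrt (alpha_s A / alpha_l A) * lam))
        ((T_0 A - Tk) / erfc (sqrt (alpha_s A / alpha_l A) * lam))"
  "conc_s (explicit_state A q0 Tk lam) = erf_profile (d_s A) (f_s A Tk) 0"
  "conc_l (explicit_state A q0 Tk lam)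
    = erf_profile (d_l A) (C_0 A - (C_0 A - f_l A Tk) / erfc (sqrt (alpha_s A / d_l A) * lam))
        ((C_0 A - f_l A Tk) / erfc (sqrt (alpha_s A / d_l A) * lam))"
  by (auto simp: explicit_state_def erf_profile_def erfc_def[of "x / y" for x y] fun_eq_iff
      diff_divide_distrib algebra_simps)

lemma solves_P1_profile_iff:
  assumes A: "initially_liquid_alloy A" and lam: "0 < lam"
    and front: "\<forall>t>0. front u t = 2 * lam * sqrt (alpha_s A * t)"
    and Ts: "\<forall>(x, t) \<in> solid_region u. temp_s u x t = erf_profile (alpha_s A) a1 b1 x t"
    and Tl: "\<forall>(x, t) \<in> liquid_region u. temp_l u x t = erf_profile (alpha_l A) a2 b2 x t"
    and Cs: "\<forall>(x, t) \<in> solid_region u. conc_s u x t = erf_profile (d_s A) a3 b3 x t"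
    and Cl: "\<forall>(x, t) \<in> liquid_region u. conc_l u x t = erf_profile (d_l A) a4 b4 x t"
  shows "solves_P1 A q0 u \<longleftrightarrow>
     heat_equation (alpha_s A) (solid_region u) (temp_s u) \<and>
     heat_equation (alpha_l A) (liquid_region u) (temp_l u) \<and>
     heat_equation (d_s A) (solid_region u) (conc_s u) \<and>
     heat_equation (d_l A) (liquid_region u) (conc_l u) \<and>
     coefficient_system A q0 (temp_k u) lam \<and>
     b1 = q0 / k_s A * sqrt (pi * alpha_s A) \<and> a1 = temp_k u - b1 * erf lam \<and>
     b2 = (T_0 A - temp_k u) / erfc (sqrt (alpha_s A / alpha_l A) * lam) \<and> a2 = T_0 A - b2 \<and>
     b3 = 0 \<and> a3 = f_s A (temp_k u) \<and>
     b4 = (C_0 A - f_l A (temp_k u)) / erfc (sqrt (alpha_s A / d_l A) * lam) \<and> a4 = C_0 A - b4"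
  unfolding solves_P1_iff[OF assms] profile_coefficients_iff[OF A lam, symmetric] by satx

lemma explicit_state_similarity_solution:
  assumes A: "initially_liquid_alloy A" and sys: "coefficient_system A q0 Tk lam"
  shows "similarity_solution A q0 (explicit_state A q0 Tk lam)"
proof -
  let ?u = "explicit_state A q0 Tk lam"
  note eqs = explicit_state_erf_profile[of A q0 Tk lam]
  have lam: "0 < lam"
    using sys by (simp add: coefficient_system_def)
  have heat: "heat_equation (alpha_s A) (solid_region ?u) (temp_s ?u)"
    "heat_equation (alpha_l A) (liquid_region ?u) (temp_l ?u)"
    "heat_equation (d_s A) (solid_region ?u) (conc_s ?u)"
    "heat_equation (d_l A) (liquid_region ?u) (conc_l ?u)"
    unfolding eqs using A
    by (auto intro!: heat_equation_erf_profile
        simp: initially_liquid_alloy_def solid_region_def liquid_region_def)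
  have form: "similarity_form \<kappa> R (erf_profile \<kappa> a b)" for \<kappa> R a b
    unfolding similarity_form_iff by blast
  have "solves_P1 A q0 ?u"
    by (rule solves_P1_profile_iff[OF A lam, THEN iffD2]) (use heat sys in \<open>simp_all add: eqs\<close>)
  then show ?thesis
    unfolding similarity_solution_def eqs using form by blast
qed

text \<open>
  The flux condition forces \<open>b \<noteq> 0\<close>. Then the constant temperature on the front determines
  \<open>erf (front u t / (2 * sqrt (alpha_s A * t)))\<close>, which is thus the same for all \<open>t\<close>, and \<open>erf\<close> is
  injective. Its argument at \<open>t = 1\<close> serves as \<open>lam\<close>.
\<close>

lemma similarity_front:
  assumes A: "initially_liquid_alloy A" and q0: "0 < q0" and u: "solves_P1 A q0 u"
    and Ts: "\<forall>(x, t) \<in> solid_region u. temp_s u x t = erf_profile (alpha_s A) a b x t"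
  shows "\<exists>lam>0. \<forall>t>0. front u t = 2 * lam * sqrt (alpha_s A * t)"
proof -
  have pos: "0 < alpha_s A" "0 < k_s A"
    using A by (auto simp: initially_liquid_alloy_def)
  have front: "0 < front u t" if "0 < t" for t
    using u that by (auto simp: solves_P1_def)
  have Ts': "temp_s u x t = erf_profile (alpha_s A) a b x t" if "0 < t" "x \<in> {0<..<front u t}" for x t
    using that Ts by (auto simp: solid_region_def)
  note bdry = erf_profile_boundary[OF pos(1) _ front Ts']
  have "((\<lambda>x. k_s A * dx (temp_s u) x 1) \<longlongrightarrow> k_s A * dx (erf_profile (alpha_s A) a b) 0 1) (at_right 0)"
    by (intro tendsto_mult tendsto_const bdry) auto
  moreover have "((\<lambda>x. k_s A * dx (temp_s u) x 1) \<longlongrightarrow> q0 / sqrt 1) (at_right 0)"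
    using u unfolding solves_P1_def by (meson zero_less_one)
  ultimately have "k_s A * dx (erf_profile (alpha_s A) a b) 0 1 = q0 / sqrt 1"
    by (rule tendsto_unique[rotated]) simp
  with pos q0 have b: "b \<noteq> 0"
    by (auto simp: dx_erf_profile)
  have melt: "a + b * erf (front u t / (2 * sqrt (alpha_s A * t))) = temp_k u" if t: "0 < t" for t
  proof -
    have "((\<lambda>x. temp_s u x t) \<longlongrightarrow> erf_profile (alpha_s A) a b (front u t) t) (at_left (front u t))"
      using t by (intro bdry)
    moreover have "((\<lambda>x. temp_s u x t) \<longlongrightarrow> temp_k u) (at_left (front u t))"
      using u t unfolding solves_P1_def by blast
    ultimately have "erf_profile (alpha_s A) a b (front u t) t = temp_k u"
      by (rule tendsto_unique[rotated]) simp
    then show ?thesis by (simp add: erf_profile_def)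
  qed
  define lam where "lam = front u 1 / (2 * sqrt (alpha_s A * 1))"
  have "front u t = 2 * lam * sqrt (alpha_s A * t)" if "0 < t" for t
  proof -
    have "a + b * erf (front u t / (2 * sqrt (alpha_s A * t))) = a + b * erf lam"
      unfolding lam_def melt[OF that] by (rule melt[symmetric]) simp
    then have "erf (front u t / (2 * sqrt (alpha_s A * t))) = erf lam"
      using b by simp
    then have eq: "front u t / (2 * sqrt (alpha_s A * t)) = lam"
      using strict_mono_erf by (simp only: strict_mono_eq)
    have "2 * sqrt (alpha_s A * t) \<noteq> 0"
      using that pos by simp
    from iffD1[OF nonzero_divide_eq_eq[OF this] eq] show ?thesis
      by (simp only: mult_ac)
  qed
  moreover have "0 < lam"
    using front[of 1] pos by (simp add: lam_def)
  ultimately show ?thesis by blast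
qed

lemma similarity_solution_imp_explicit_state:
  assumes A: "initially_liquid_alloy A" and q0: "0 < q0" and u: "similarity_solution A q0 u"
  shows "\<exists>lam. coefficient_system A q0 (temp_k u) lam \<and> same_state u (explicit_state A q0 (temp_k u) lam)"
proof -
  have sol: "solves_P1 A q0 u"
    using u by (simp add: similarity_solution_def)
  obtain a1 b1 where Ts: "\<forall>(x, t) \<in> solid_region u. temp_s u x t = erf_profile (alpha_s A) a1 b1 x t"
    using u unfolding similarity_solution_def similarity_form_iff by blast
  obtain a2 b2 where Tl: "\<forall>(x, t) \<in> liquid_region u. temp_l u x t = erf_profile (alpha_l A) a2 b2 x t"
    using u unfolding similarity_solution_def similarity_form_iff by blast
  obtain a3 b3 where Cs: "\<forall>(x, t) \<in> solid_region u. conc_s u x t = erf_profile (d_s A) a3 b3 x t"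
    using u unfolding similarity_solution_def similarity_form_iff by blast
  obtain a4 b4 where Cl: "\<forall>(x, t) \<in> liquid_region u. conc_l u x t = erf_profile (d_l A) a4 b4 x t"
    using u unfolding similarity_solution_def similarity_form_iff by blast
  obtain lam where lam: "0 < lam" and front: "\<forall>t>0. front u t = 2 * lam * sqrt (alpha_s A * t)"
    using similarity_front[OF A q0 sol Ts] by blast
  have "coefficient_system A q0 (temp_k u) lam \<and>
     b1 = q0 / k_s A * sqrt (pi * alpha_s A) \<and> a1 = temp_k u - b1 * erf lam \<and>
     b2 = (T_0 A - temp_k u) / erfc (sqrt (alpha_s A / alpha_l A) * lam) \<and> a2 = T_0 A - b2 \<and>
     b3 = 0 \<and> a3 = f_s A (temp_k u) \<and>
     b4 = (C_0 A - f_l A (temp_k u)) / erfc (sqrt (alpha_s A / d_l A) * lam) \<and> a4 = C_0 A - b4"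
    using sol unfolding solves_P1_profile_iff[OF A lam front Ts Tl Cs Cl] by satx
  then have "coefficient_system A q0 (temp_k u) lam"
    and "same_state u (explicit_state A q0 (temp_k u) lam)"
    using front Ts Tl Cs Cl by (auto simp: same_state_def explicit_state_erf_profile)
  then show ?thesis by blast
qed

theorem theorem2p1:
  fixes A :: alloy and q0 :: real
  assumes "initially_liquid_alloy A"
    and "q0 > 0"
    and "(T_0 A - T_0l A) * k_l A / sqrt (pi * alpha_l A) < q0"
    and "q0 < (T_0 A - T_0s A) * k_l A / sqrt (pi * alpha_l A)"
  shows "\<exists>Tk lam.
           coefficient_system A q0 Tk lam \<and>
           (\<forall>Tk' lam'. coefficient_system A q0 Tk' lam' \<longrightarrow> Tk' = Tk \<and> lam' = lam) \<and>
           similarity_solution A q0 (explicit_state A q0 Tk lam) \<and>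
           (\<forall>u. similarity_solution A q0 u \<longrightarrow> same_state u (explicit_state A q0 Tk lam))"
proof -
  note A = assms(1) and q0 = assms(2)
  have "0 < k_l A" "0 < sqrt (pi * alpha_l A)"
    using A by (auto simp: initially_liquid_alloy_def)
  then have "T_0s A < F_fun A q0 0" "F_fun A q0 0 < T_0l A"
    using assms(3,4) by (simp_all add: F_fun_0 field_simps)
  from coefficient_system_solvable[OF A q0 this]
  obtain Tk lam where sys: "coefficient_system A q0 Tk lam" by blast
  note unique = coefficient_system_unique[OF A q0 _ sys]
  have "same_state u (explicit_state A q0 Tk lam)" if "similarity_solution A q0 u" for u
    using similarity_solution_imp_explicit_state[OF A q0 that] unique by metis
  with sys unique explicit_state_similarity_solution[OF A sys] show ?thesis
    by blast
qed

end
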